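(* Let $f:\mathcal{M}_1\to\mathcal{M}_2$ be a local diffeomorphism between smooth, oriented, $d$-dimensional Riemannian manifolds with boundaries $(\mathcal{M}_1,\mathfrak{g}_1)$ and $(\mathcal{M}_2,\mathfrak{g}_2)$. Then $$\delta_{\nabla^{f^*T\mathcal{M}_2}}\,\operatorname{Cof}df=0 .$$
   Context: For an oriented $d$-dimensional inner-product space $V$, let $\Lambda_k(V)$ be its $k$-th exterior power and $\star_V^k:\Lambda_k(V)\to\Lambda_{d-k}(V)$ the Hodge-dual operator ($\alpha\wedge\star_V^k\beta=\langle\alpha,\beta\rangle\, e_1\wedge\dots\wedge e_d$ for a positively-oriented orthonormal basis $(e_i)$). For a linear map $A:V\to W$ between oriented $d$-dimensional inner-product spaces, $\operatorname{Cof}A:=(-1)^{d-1}\star_W^{d-1}\circ\bigwedge^{d-1}A\circ\star_V^1:V\to W$. (In positively-oriented orthonormal bases it is represented by the matrix-cofactor, i.e. the transpose of the adjugate, of the matrix of $A$.) The differential is viewed as a bundle map $df:T\mathcal{M}_1\to f^*T\mathcal{M}_2$, and $\operatorname{Cof}df\in\Gamma(T^*\mathcal{M}_1\otimes f^*T\mathcal{M}_2)=\Omega^1(\mathcal{M}_1;f^*T\mathcal{M}_2)$ is defined fiberwise. The bundle $f^*T\mathcal{M}_2$ carries the pullback metric and the pullback $\nabla^{f^*T\mathcal{M}_2}$ of the Levi-Civita connection of $\mathcal{M}_2$. For $\omega\in\Omega^1(\mathcal{M}_1;f^*T\mathcal{M}_2)$, the coderivative is $\delta_{\nabla^{f^*T\mathcal{M}_2}}\omega=-\sum_{i=1}^d(\nabla_{E_i}\omega)(E_i)\in\Gamma(f^*T\mathcal{M}_2)$,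 where $(E_i)$ is any local orthonormal frame of $T\mathcal{M}_1$ and $\nabla$ is the connection on $T^*\mathcal{M}_1\otimes f^*T\mathcal{M}_2$ induced by the Levi-Civita connection of $\mathcal{M}_1$ and $\nabla^{f^*T\mathcal{M}_2}$ (it is the formal adjoint of $\nabla^{f^*T\mathcal{M}_2}$ acting on sections). *)

theory Defs
  imports "HOL-Analysis.Analysis"
begin

section \<open>Linear algebra of an oriented inner-product space\<close>

text \<open>
  An oriented inner-product space of dimension \<open>d = CARD('d)\<close> is the vector space \<open>real^'d\<close>
  with an arbitrary inner product \<open>g\<close> and an orientation \<open>s\<close>, where \<open>s = 1\<close> if the standard
  basis (in the order of \<open>'d\<close>) is positively oriented and \<open>s = -1\<close> otherwise.
\<close>

type_synonym 'd rvec = "(real, 'd) vec"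
type_synonym 'd ext = "(real, 'd set) vec"

definition inner_product :: "('d::finite rvec \<Rightarrow> 'd rvec \<Rightarrow> real) \<Rightarrow> bool" where
  "inner_product g \<longleftrightarrow>
     bilinear g \<and> (\<forall>u v. g u v = g v u) \<and> (\<forall>u. u \<noteq> 0 \<longrightarrow> g u u > 0)"

definition orthonormal_basis ::
  "('d::finite rvec \<Rightarrow> 'd rvec \<Rightarrow> real) \<Rightarrow> ('d \<Rightarrow> 'd rvec) \<Rightarrow> bool" where
  "orthonormal_basis g E \<longleftrightarrow> (\<forall>i j. g (E i) (E j) = (if i = j then 1 else 0))"

definition pos_orthonormal_basis ::
  "('d::finite rvec \<Rightarrow> 'd rvec \<Rightarrow> real) \<Rightarrow> real \<Rightarrow> ('d \<Rightarrow> 'd rvec) \<Rightarrow> bool" where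
  "pos_orthonormal_basis g s E \<longleftrightarrow>
     orthonormal_basis g E \<and> s * det (\<chi> i j. E j $ i) > 0"

subsection \<open>Exterior powers\<close>

text \<open>
  The exterior algebra of \<open>real^'d\<close> is \<open>'d ext\<close>, that is, \<open>real^('d set)\<close>: the coefficient at
  \<open>S = {s\<^sub>1 < \<dots> < s\<^sub>k}\<close> is the one of \<open>e\<^sub>S = e\<^bsub>s\<^sub>1\<^esub> \<and> \<dots> \<and> e\<^bsub>s\<^sub>k\<^esub>\<close>, and the \<open>k\<close>-th exterior power
  is the subspace spanned by the \<open>e\<^sub>S\<close> with \<open>card S = k\<close>. The wedge product is determined by
  \<open>e\<^sub>T \<and> e\<^sub>U = \<plusminus> e\<^bsub>T \<union> U\<^esub>\<close> for disjoint \<open>T\<close>, \<open>U\<close> (and \<open>0\<close> otherwise), the sign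
  being the parity of the number of inversions between \<open>T\<close> and \<open>U\<close>.
\<close>

definition ext_power :: "nat \<Rightarrow> ('d::finite ext) set" where
  "ext_power k = {\<alpha>. \<forall>S. card S \<noteq> k \<longrightarrow> \<alpha> $ S = 0}"

definition shuffle_sign :: "'d::linorder set \<Rightarrow> 'd set \<Rightarrow> real" where
  "shuffle_sign T U = (-1) ^ card {(t, u). t \<in> T \<and> u \<in> U \<and> u < t}"

definition wedge ::
  "'d::{finite,linorder} ext \<Rightarrow> 'd ext \<Rightarrow> 'd ext" where
  "wedge \<alpha> \<beta> = (\<chi> S. \<Sum>T\<in>Pow S. shuffle_sign T (S - T) * \<alpha> $ T * \<beta> $ (S - T))"

definition vec_to_ext :: "'d rvec \<Rightarrow> 'd::finite ext" where
  "vec_to_ext v = (\<chi> S. \<Sum>i\<in>UNIV. if S = {i} then v $ i else 0)"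

definition ext_to_vec :: "'d::finite ext \<Rightarrow> 'd rvec" where
  "ext_to_vec \<alpha> = (\<chi> i. \<alpha> $ {i})"

definition wedge_list :: "('d::{finite,linorder} rvec) list \<Rightarrow> 'd ext" where
  "wedge_list vs = foldr (\<lambda>v. wedge (vec_to_ext v)) vs (axis {} 1)"

text \<open>
  The restriction of \<open>ext_map A\<close> to \<open>ext_power k\<close> is the \<open>k\<close>-th exterior power of the linear map
  \<open>A\<close>.
\<close>

definition ext_map ::
  "('d rvec \<Rightarrow> 'd rvec) \<Rightarrow> 'd::{finite,linorder} ext \<Rightarrow> 'd ext" where
  "ext_map A \<alpha> =
     (\<Sum>S\<in>UNIV. \<alpha> $ S *\<^sub>R wedge_list (map (\<lambda>i. A (axis i 1)) (sorted_list_of_set S)))"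

text \<open>
  The inner product induced on exterior powers,
  \<open>\<langle>v\<^sub>1 \<and> \<dots> \<and> v\<^sub>k, w\<^sub>1 \<and> \<dots> \<and> w\<^sub>k\<rangle> = det (\<langle>v\<^sub>i, w\<^sub>j\<rangle>)\<close>, different powers being orthogonal. The
  determinant is written out because its size \<open>k\<close> is not given by a type.
\<close>

definition gram_det ::
  "('d::finite rvec \<Rightarrow> 'd rvec \<Rightarrow> real) \<Rightarrow> ('d rvec) list \<Rightarrow> ('d rvec) list \<Rightarrow> real" where
  "gram_det g vs ws =
     (\<Sum>\<pi> | \<pi> permutes {..<length vs}.
        of_int (sign \<pi>) * (\<Prod>i<length vs. g (vs ! i) (ws ! \<pi> i)))"

definition ext_inner ::
  "('d rvec \<Rightarrow> 'd rvec \<Rightarrow> real) \<Rightarrow> 'd::{finite,linorder} ext \<Rightarrow> 'd ext \<Rightarrow> real" where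
  "ext_inner g \<alpha> \<beta> =
     (\<Sum>S\<in>UNIV. \<Sum>T | card T = card S. \<alpha> $ S * \<beta> $ T *
        gram_det g (map (\<lambda>i. axis i 1) (sorted_list_of_set S))
                   (map (\<lambda>i. axis i 1) (sorted_list_of_set T)))"

subsection \<open>Hodge star and cofactor\<close>

definition hodge_star ::
  "('d rvec \<Rightarrow> 'd rvec \<Rightarrow> real) \<Rightarrow> real \<Rightarrow> nat \<Rightarrow>
   'd::{finite,linorder} ext \<Rightarrow> 'd ext" where
  "hodge_star g s k \<beta> =
     (THE \<gamma>. \<gamma> \<in> ext_power (CARD('d) - k) \<and>
        (\<forall>\<alpha>\<in>ext_power k. \<forall>E. pos_orthonormal_basis g s E \<longrightarrow>
           wedge \<alpha> \<gamma> = ext_inner g \<alpha> \<beta> *\<^sub>R wedge_list (map E (sorted_list_of_set UNIV))))"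

text \<open>
  The cofactor of \<open>A : V \<rightarrow> W\<close> for \<open>V = (real^'d, g, s)\<close> and \<open>W = (real^'d, h, t)\<close>; the first
  exterior powers are identified with the spaces themselves.
\<close>

definition Cof ::
  "('d rvec \<Rightarrow> 'd rvec \<Rightarrow> real) \<Rightarrow> real \<Rightarrow> ('d rvec \<Rightarrow> 'd rvec \<Rightarrow> real) \<Rightarrow> real \<Rightarrow>
   ('d rvec \<Rightarrow> 'd rvec) \<Rightarrow> 'd::{finite,linorder} rvec \<Rightarrow> 'd rvec" where
  "Cof g s h t A v =
     (-1) ^ (CARD('d) - 1) *\<^sub>R
       ext_to_vec (hodge_star h t (CARD('d) - 1)
         (ext_map A (hodge_star g s 1 (vec_to_ext v))))"


section \<open>Calculus up to the boundary of a half-space\<close>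

definition half_space :: "('d::{finite,linorder} rvec) set" where
  "half_space = {x. 0 \<le> x $ Max UNIV}"

fun Ck_on :: "nat \<Rightarrow> ('v::real_normed_vector \<Rightarrow> 'w::real_normed_vector) \<Rightarrow> 'v set \<Rightarrow> bool" where
  "Ck_on 0 F U \<longleftrightarrow> continuous_on U F"
| "Ck_on (Suc k) F U \<longleftrightarrow>
     (\<exists>F'. (\<forall>x\<in>U. (F has_derivative F' x) (at x)) \<and> (\<forall>v. Ck_on k (\<lambda>x. F' x v) U))"

text \<open>Smoothness on a set that need not be open: existence of local smooth extensions.\<close>

definition smooth_on ::
  "('v::real_normed_vector) set \<Rightarrow> ('v \<Rightarrow> 'w::real_normed_vector) \<Rightarrow> bool" where
  "smooth_on S F \<longleftrightarrow>
     (\<forall>x\<in>S. \<exists>U G. open U \<and> x \<in> U \<and> (\<forall>k. Ck_on k G U) \<and> (\<forall>y\<in>S \<inter> U. G y = F y))"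

text \<open>The derivative is one-sided at boundary points of the half-space.\<close>

definition hderiv ::
  "('d::{finite,linorder} rvec \<Rightarrow> 'w::real_normed_vector) \<Rightarrow> 'd rvec \<Rightarrow> 'd rvec \<Rightarrow> 'w" where
  "hderiv F x = frechet_derivative F (at x within half_space)"


section \<open>Oriented Riemannian manifolds with boundary\<close>

text \<open>
  A chart is a pair of its domain and its coordinate map. Vectors and tensors at a point \<open>p\<close> are
  given by their components with respect to each chart around \<open>p\<close>: a tangent vector has
  components \<open>u\<close> in the chart \<open>c\<close> and \<open>hderiv (chart_change c c') (snd c p) u\<close> in the chart \<open>c'\<close>.
  The field \<open>mfd_metric M c p\<close> is the metric at \<open>p\<close> in the components of \<open>c\<close>, and
  \<open>mfd_orient M c p\<close> is \<open>1\<close> or \<open>-1\<close> according to whether the coordinate basis of \<open>c\<close> at \<open>p\<close> is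
  positively oriented.
\<close>

type_synonym ('a, 'd) chart = "'a set \<times> ('a \<Rightarrow> 'd rvec)"

record ('a, 'd::finite) riem_mfd =
  mfd_top :: "'a topology"
  mfd_atlas :: "('a, 'd) chart set"
  mfd_metric :: "('a, 'd) chart \<Rightarrow> 'a \<Rightarrow> 'd rvec \<Rightarrow> 'd rvec \<Rightarrow> real"
  mfd_orient :: "('a, 'd) chart \<Rightarrow> 'a \<Rightarrow> real"

definition chart_inv :: "('a, 'd::finite) chart \<Rightarrow> 'd rvec \<Rightarrow> 'a" where
  "chart_inv c = inv_into (fst c) (snd c)"

definition chart_change :: "('a, 'd::finite) chart \<Rightarrow> ('a, 'd) chart \<Rightarrow> 'd rvec \<Rightarrow> 'd rvec" where
  "chart_change c c' = snd c' \<circ> chart_inv c"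

definition smooth_manifold :: "('a, 'd::{finite,linorder}) riem_mfd \<Rightarrow> bool" where
  "smooth_manifold M \<longleftrightarrow>
     Hausdorff_space (mfd_top M) \<and> second_countable (mfd_top M) \<and>
     (\<Union>c\<in>mfd_atlas M. fst c) = topspace (mfd_top M) \<and>
     (\<forall>c\<in>mfd_atlas M.
        openin (mfd_top M) (fst c) \<and>
        openin (top_of_set half_space) (snd c ` fst c) \<and>
        homeomorphic_map (subtopology (mfd_top M) (fst c)) (top_of_set (snd c ` fst c)) (snd c)) \<and>
     (\<forall>c\<in>mfd_atlas M. \<forall>c'\<in>mfd_atlas M. smooth_on (snd c ` (fst c \<inter> fst c')) (chart_change c c'))"

definition riemannian_metric :: "('a, 'd::{finite,linorder}) riem_mfd \<Rightarrow> bool" where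
  "riemannian_metric M \<longleftrightarrow>
     (\<forall>c\<in>mfd_atlas M.
        (\<forall>p\<in>fst c. inner_product (mfd_metric M c p)) \<and>
        (\<forall>u v. smooth_on (snd c ` fst c) (\<lambda>x. mfd_metric M c (chart_inv c x) u v))) \<and>
     (\<forall>c\<in>mfd_atlas M. \<forall>c'\<in>mfd_atlas M. \<forall>p\<in>fst c \<inter> fst c'. \<forall>u v.
        mfd_metric M c p u v =
          mfd_metric M c' p (hderiv (chart_change c c') (snd c p) u)
                            (hderiv (chart_change c c') (snd c p) v))"

definition orientation :: "('a, 'd::{finite,linorder}) riem_mfd \<Rightarrow> bool" where
  "orientation M \<longleftrightarrow>
     (\<forall>c\<in>mfd_atlas M.
        (\<forall>p\<in>fst c. mfd_orient M c p \<in> {1, -1}) \<and>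
        continuous_map (subtopology (mfd_top M) (fst c)) euclideanreal (mfd_orient M c)) \<and>
     (\<forall>c\<in>mfd_atlas M. \<forall>c'\<in>mfd_atlas M. \<forall>p\<in>fst c \<inter> fst c'.
        mfd_orient M c p =
          sgn (det (matrix (hderiv (chart_change c c') (snd c p)))) * mfd_orient M c' p)"

definition oriented_riemannian_manifold :: "('a, 'd::{finite,linorder}) riem_mfd \<Rightarrow> bool" where
  "oriented_riemannian_manifold M \<longleftrightarrow>
     smooth_manifold M \<and> riemannian_metric M \<and> orientation M"


section \<open>Local diffeomorphisms and the differential\<close>

definition smooth_map_on ::
  "('a, 'd::{finite,linorder}) riem_mfd \<Rightarrow> ('b, 'd) riem_mfd \<Rightarrow> 'a set \<Rightarrow> ('a \<Rightarrow> 'b) \<Rightarrow> bool" where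
  "smooth_map_on M N W f \<longleftrightarrow>
     continuous_map (subtopology (mfd_top M) W) (mfd_top N) f \<and>
     (\<forall>c\<in>mfd_atlas M. \<forall>c'\<in>mfd_atlas N.
        smooth_on (snd c ` {p \<in> fst c \<inter> W. f p \<in> fst c'}) (snd c' \<circ> f \<circ> chart_inv c))"

definition local_diffeomorphism ::
  "('a, 'd::{finite,linorder}) riem_mfd \<Rightarrow> ('b, 'd) riem_mfd \<Rightarrow> ('a \<Rightarrow> 'b) \<Rightarrow> bool" where
  "local_diffeomorphism M N f \<longleftrightarrow>
     (\<forall>p\<in>topspace (mfd_top M). \<exists>W. openin (mfd_top M) W \<and> p \<in> W \<and> openin (mfd_top N) (f ` W) \<and>
        inj_on f W \<and> smooth_map_on M N W f \<and> smooth_map_on N M (f ` W) (inv_into W f))"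

text \<open>
  Below, \<open>c\<close> is a chart around \<open>p\<close> and \<open>c'\<close> a chart around \<open>f p\<close>; the components of a one-form
  \<open>\<omega>\<close> with values in the pullback bundle are the linear maps \<open>\<omega> c c' p\<close>.
\<close>

definition differential ::
  "('a \<Rightarrow> 'b) \<Rightarrow> ('a, 'd::{finite,linorder}) chart \<Rightarrow> ('b, 'd) chart \<Rightarrow> 'a \<Rightarrow> 'd rvec \<Rightarrow> 'd rvec" where
  "differential f c c' p = hderiv (snd c' \<circ> f \<circ> chart_inv c) (snd c p)"

definition Cof_differential ::
  "('a, 'd::{finite,linorder}) riem_mfd \<Rightarrow> ('b, 'd) riem_mfd \<Rightarrow> ('a \<Rightarrow> 'b) \<Rightarrow>
   ('a, 'd) chart \<Rightarrow> ('b, 'd) chart \<Rightarrow> 'a \<Rightarrow> 'd rvec \<Rightarrow> 'd rvec" where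
  "Cof_differential M N f c c' p =
     Cof (mfd_metric M c p) (mfd_orient M c p) (mfd_metric N c' (f p)) (mfd_orient N c' (f p))
       (differential f c c' p)"


section \<open>Connections and the coderivative\<close>

text \<open>
  A connection on the tangent bundle is, in the chart \<open>c\<close>, of the form
  \<open>\<nabla>\<^sub>v Y = dY(v) + \<Gamma>(v, Y)\<close> with \<open>\<Gamma>\<close> bilinear. The Levi-Civita connection is the torsion-free
  (that is, \<open>\<Gamma>\<close> is symmetric) connection that is compatible with the metric:
  \<open>u\<langle>v, w\<rangle> = \<langle>\<nabla>\<^sub>u v, w\<rangle> + \<langle>v, \<nabla>\<^sub>u w\<rangle>\<close>, here for vector fields \<open>v\<close>, \<open>w\<close> with constant
  components, to which the general case reduces by the Leibniz rule.
\<close>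

definition levi_civita_coeff ::
  "('d::finite rvec \<Rightarrow> 'd rvec \<Rightarrow> real) \<Rightarrow> ('d rvec \<Rightarrow> 'd rvec \<Rightarrow> 'd rvec \<Rightarrow> real) \<Rightarrow>
   ('d rvec \<Rightarrow> 'd rvec \<Rightarrow> 'd rvec) \<Rightarrow> bool" where
  "levi_civita_coeff g Dg \<Gamma> \<longleftrightarrow>
     bilinear \<Gamma> \<and> (\<forall>u v. \<Gamma> u v = \<Gamma> v u) \<and>
     (\<forall>u v w. Dg u v w = g (\<Gamma> u v) w + g v (\<Gamma> u w))"

definition metric_deriv ::
  "('a, 'd::{finite,linorder}) riem_mfd \<Rightarrow> ('a, 'd) chart \<Rightarrow> 'a \<Rightarrow>
   'd rvec \<Rightarrow> 'd rvec \<Rightarrow> 'd rvec \<Rightarrow> real" where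
  "metric_deriv M c p u v w = hderiv (\<lambda>x. mfd_metric M c (chart_inv c x) v w) (snd c p) u"

definition christoffel ::
  "('a, 'd::{finite,linorder}) riem_mfd \<Rightarrow> ('a, 'd) chart \<Rightarrow> 'a \<Rightarrow>
   'd rvec \<Rightarrow> 'd rvec \<Rightarrow> 'd rvec" where
  "christoffel M c p = (THE \<Gamma>. levi_civita_coeff (mfd_metric M c p) (metric_deriv M c p) \<Gamma>)"

text \<open>Covariant derivative in direction \<open>v\<close> of a vector field \<open>Y\<close> on \<open>M\<close>, in the chart \<open>c\<close>.\<close>

definition cov_deriv ::
  "('a, 'd::{finite,linorder}) riem_mfd \<Rightarrow> ('a, 'd) chart \<Rightarrow> ('a \<Rightarrow> 'd rvec) \<Rightarrow>
   'a \<Rightarrow> 'd rvec \<Rightarrow> 'd rvec" where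
  "cov_deriv M c Y p v = hderiv (Y \<circ> chart_inv c) (snd c p) v + christoffel M c p v (Y p)"

text \<open>
  Covariant derivative in direction \<open>v\<close> of a section \<open>\<sigma>\<close> of the pullback bundle, whose values
  \<open>\<sigma> p\<close> are the components in \<open>c'\<close> of vectors tangent to \<open>N\<close> at \<open>f p\<close>. This is the connection
  with \<open>\<nabla>\<^sub>v (Y \<circ> f) = (\<nabla>\<^bsub>df v\<^esub> Y) \<circ> f\<close>.
\<close>

definition pullback_cov_deriv ::
  "('b, 'd::{finite,linorder}) riem_mfd \<Rightarrow> ('a \<Rightarrow> 'b) \<Rightarrow> ('a, 'd) chart \<Rightarrow> ('b, 'd) chart \<Rightarrow>
   ('a \<Rightarrow> 'd rvec) \<Rightarrow> 'a \<Rightarrow> 'd rvec \<Rightarrow> 'd rvec" where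
  "pullback_cov_deriv N f c c' \<sigma> p v =
     hderiv (\<sigma> \<circ> chart_inv c) (snd c p) v
       + christoffel N c' (f p) (differential f c c' p v) (\<sigma> p)"

text \<open>
  The induced connection, \<open>(\<nabla>\<^sub>v \<omega>)(Y) = \<nabla>\<^sub>v (\<omega>(Y)) - \<omega>(\<nabla>\<^sub>v Y)\<close>. The right-hand side depends only
  on the value \<open>w\<close> of \<open>Y\<close> at \<open>p\<close>, so \<open>Y\<close> is taken to have constant components \<open>w\<close> in \<open>c\<close>.
\<close>

definition form_cov_deriv ::
  "('a, 'd::{finite,linorder}) riem_mfd \<Rightarrow> ('b, 'd) riem_mfd \<Rightarrow> ('a \<Rightarrow> 'b) \<Rightarrow>
   (('a, 'd) chart \<Rightarrow> ('b, 'd) chart \<Rightarrow> 'a \<Rightarrow> 'd rvec \<Rightarrow> 'd rvec) \<Rightarrow>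
   ('a, 'd) chart \<Rightarrow> ('b, 'd) chart \<Rightarrow> 'a \<Rightarrow> 'd rvec \<Rightarrow> 'd rvec \<Rightarrow> 'd rvec" where
  "form_cov_deriv M N f \<omega> c c' p v w =
     pullback_cov_deriv N f c c' (\<lambda>q. \<omega> c c' q w) p v - \<omega> c c' p (cov_deriv M c (\<lambda>q. w) p v)"

text \<open>The choice of the orthonormal basis is immaterial, see \<open>coderivative_eq\<close> below.\<close>

definition coderivative ::
  "('a, 'd::{finite,linorder}) riem_mfd \<Rightarrow> ('b, 'd) riem_mfd \<Rightarrow> ('a \<Rightarrow> 'b) \<Rightarrow>
   (('a, 'd) chart \<Rightarrow> ('b, 'd) chart \<Rightarrow> 'a \<Rightarrow> 'd rvec \<Rightarrow> 'd rvec) \<Rightarrow>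
   ('a, 'd) chart \<Rightarrow> ('b, 'd) chart \<Rightarrow> 'a \<Rightarrow> 'd rvec" where
  "coderivative M N f \<omega> c c' p =
     (let E = (SOME E. orthonormal_basis (mfd_metric M c p) E)
      in - (\<Sum>i\<in>UNIV. form_cov_deriv M N f \<omega> c c' p (E i) (E i)))"


section \<open>Well-definedness of the choices\<close>

lemma orthonormal_coords:
  fixes g :: "'d::finite rvec \<Rightarrow> 'd rvec \<Rightarrow> real"
  assumes g: "inner_product g" and E: "orthonormal_basis g E"
  shows "v = (\<Sum>j\<in>UNIV. g v (E j) *\<^sub>R E j)"
proof -
  have bil: "bilinear g"
    using g by (simp add: inner_product_def)
  then have lin: "linear (\<lambda>v. g v w)" for w
    by (simp add: bilinear_def)
  define T where "T v = (\<chi> j. g v (E j))" for v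
  have T: "linear T"
    unfolding T_def
    by (rule linearI) (auto simp: vec_eq_iff bilinear_ladd[OF bil] bilinear_lmul[OF bil])
  have Tsum: "T (\<Sum>j\<in>UNIV. a j *\<^sub>R E j) = (\<chi> j. a j)" for a
  proof -
    have "g (\<Sum>k\<in>UNIV. a k *\<^sub>R E k) (E j) = a j" for j
    proof -
      have "g (\<Sum>k\<in>UNIV. a k *\<^sub>R E k) (E j) = (\<Sum>k\<in>UNIV. a k * g (E k) (E j))"
        by (simp add: linear_sum[OF lin] bilinear_lmul[OF bil])
      also have "\<dots> = (\<Sum>k\<in>UNIV. if k = j then a k else 0)"
        using E unfolding orthonormal_basis_def by (intro sum.cong) auto
      also have "\<dots> = a j" by simp
      finally show ?thesis .
    qed
    then show ?thesis by (simp add: T_def)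
  qed
  have "surj T"
  proof (rule surjI)
    show "T (\<Sum>j\<in>UNIV. y $ j *\<^sub>R E j) = y" for y
      by (simp add: Tsum)
  qed
  then have "inj T"
    using T linear_surjective_imp_injective by blast
  moreover have "T v = T (\<Sum>j\<in>UNIV. g v (E j) *\<^sub>R E j)"
    by (simp only: Tsum) (simp add: T_def)
  ultimately show ?thesis
    by (simp add: inj_eq)
qed

lemma orthonormal_basis_exists:
  fixes g :: "'d::finite rvec \<Rightarrow> 'd rvec \<Rightarrow> real"
  assumes g: "inner_product g"
  shows "\<exists>E. orthonormal_basis g E"
proof -
  have bil: "bilinear g" and sym: "\<And>u v. g u v = g v u" and pos: "\<And>u. u \<noteq> 0 \<Longrightarrow> g u u > 0"
    using g by (auto simp: inner_product_def)
  have "\<exists>E. \<forall>i\<in>S. \<forall>j\<in>S. g (E i) (E j) = (if i = j then 1 else 0)" if "finite S" for S :: "'d set"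
    using that
  proof (induction S rule: finite_induct)
    case (insert i S)
    then obtain E where E: "\<forall>i\<in>S. \<forall>j\<in>S. g (E i) (E j) = (if i = j then 1 else 0)"
      by blast
    define T :: "'d rvec \<Rightarrow> 'd rvec" where "T v = (\<chi> j. if j \<in> S then g v (E j) else 0)" for v
    have T: "linear T"
      unfolding T_def
      by (rule linearI) (auto simp: vec_eq_iff bilinear_ladd[OF bil] bilinear_lmul[OF bil])
    have "axis i 1 \<notin> range T"
    proof
      assume "axis i 1 \<in> range T"
      then obtain v where "axis i 1 = T v" by blast
      then have "axis i 1 $ i = T v $ i" by (rule arg_cong)
      then show False using insert.hyps by (simp add: T_def)
    qed
    then have "\<not> inj T"
      using linear_injective_imp_surjective[OF T] by (metis UNIV_I)
    then obtain v where v: "T v = 0" "v \<noteq> 0"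
      using linear_injective_0[OF T] by blast
    have gv: "g v (E j) = 0" if "j \<in> S" for j
      using v(1) that by (auto simp: T_def vec_eq_iff split: if_splits)
    define w where "w = (1 / sqrt (g v v)) *\<^sub>R v"
    have "g w w = 1"
      using pos[OF v(2)] by (simp add: w_def bilinear_lmul[OF bil] bilinear_rmul[OF bil])
    moreover have "g w (E j) = 0" "g (E j) w = 0" if "j \<in> S" for j
      using gv[OF that] sym by (simp_all add: w_def bilinear_lmul[OF bil] bilinear_rmul[OF bil])
    ultimately have "\<forall>k\<in>insert i S. \<forall>j\<in>insert i S.
        g ((E(i := w)) k) ((E(i := w)) j) = (if k = j then 1 else 0)"
      using E insert.hyps by auto
    then show ?case by blast
  qed simp
  from this[of UNIV] show ?thesis
    by (simp add: orthonormal_basis_def)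
qed

lemma orthonormal_trace_indep:
  fixes B :: "'d::finite rvec \<Rightarrow> 'd rvec \<Rightarrow> 'd rvec"
  assumes g: "inner_product g" and B: "bilinear B"
    and E: "orthonormal_basis g E" and F: "orthonormal_basis g F"
  shows "(\<Sum>i\<in>UNIV. B (F i) (F i)) = (\<Sum>i\<in>UNIV. B (E i) (E i))"
proof -
  have bil: "bilinear g" and sym: "\<And>u v. g u v = g v u"
    using g by (auto simp: inner_product_def)
  define P :: "real^'d^'d" where "P = (\<chi> i j. g (F i) (E j))"
  have F_eq: "F i = (\<Sum>j\<in>UNIV. P $ i $ j *\<^sub>R E j)" for i
    using orthonormal_coords[OF g E, of "F i"] by (simp add: P_def)
  have rlin: "linear (g u)" for u
    using bil by (simp add: bilinear_def)
  have "(\<Sum>k\<in>UNIV. P $ i $ k * P $ j $ k) = (if i = j then 1 else 0)" for i j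
  proof -
    have "g (F i) (F j) = (\<Sum>k\<in>UNIV. P $ j $ k * P $ i $ k)"
      by (subst F_eq[of j]) (simp add: linear_sum[OF rlin] bilinear_rmul[OF bil] P_def)
    then show ?thesis
      using F by (simp add: orthonormal_basis_def mult.commute)
  qed
  then have "P ** transpose P = mat 1"
    by (simp add: matrix_matrix_mult_def transpose_def mat_def vec_eq_iff)
  then have "transpose P ** P = mat 1"
    by (simp add: matrix_left_right_inverse)
  then have P: "(\<Sum>i\<in>UNIV. P $ i $ j * P $ i $ k) = (if j = k then 1 else 0)" for j k
    by (simp add: matrix_matrix_mult_def transpose_def mat_def vec_eq_iff)
  have "(\<Sum>i\<in>UNIV. B (F i) (F i))
      = (\<Sum>i\<in>UNIV. \<Sum>(j, k)\<in>UNIV \<times> UNIV. (P $ i $ j * P $ i $ k) *\<^sub>R B (E j) (E k))"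
    by (simp add: F_eq bilinear_sum[OF B] bilinear_lmul[OF B] bilinear_rmul[OF B] mult.commute)
  also have "\<dots> = (\<Sum>(j, k)\<in>UNIV \<times> UNIV. \<Sum>i\<in>UNIV. (P $ i $ j * P $ i $ k) *\<^sub>R B (E j) (E k))"
    by (subst sum.swap) (simp add: case_prod_unfold)
  also have "\<dots> = (\<Sum>j\<in>UNIV. \<Sum>k\<in>UNIV. (\<Sum>i\<in>UNIV. P $ i $ j * P $ i $ k) *\<^sub>R B (E j) (E k))"
    by (simp only: sum.cartesian_product[symmetric] scaleR_sum_left)
  also have "\<dots> = (\<Sum>j\<in>UNIV. \<Sum>k\<in>UNIV. if k = j then B (E j) (E k) else 0)"
    unfolding P by (intro sum.cong) auto
  finally show ?thesis by simp
qed

lemma coderivative_eq: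
  assumes "inner_product (mfd_metric M c p)" "orthonormal_basis (mfd_metric M c p) E"
    and "bilinear (form_cov_deriv M N f \<omega> c c' p)"
  shows "coderivative M N f \<omega> c c' p = - (\<Sum>i\<in>UNIV. form_cov_deriv M N f \<omega> c c' p (E i) (E i))"
  unfolding coderivative_def Let_def
  using orthonormal_trace_indep[OF assms(1,3,2)] someI[of "orthonormal_basis _", OF assms(2)]
  by simp

lemma levi_civita_coeff_ex1:
  fixes g :: "'d::finite rvec \<Rightarrow> 'd rvec \<Rightarrow> real"
  assumes g: "inner_product g"
    and D: "\<And>u. bilinear (Dg u)" "\<And>u v w. Dg u v w = Dg u w v" "\<And>v w. linear (\<lambda>u. Dg u v w)"
  shows "\<exists>!\<Gamma>. levi_civita_coeff g Dg \<Gamma>"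
proof -
  have bil: "bilinear g" and sym: "\<And>u v. g u v = g v u" and pos: "\<And>u. u \<noteq> 0 \<Longrightarrow> g u u > 0"
    using g by (auto simp: inner_product_def)
  have nondeg: "z = z'" if "\<And>w. g z w = g z' w" for z z'
    using that[of "z - z'"] pos[of "z - z'"] bilinear_lsub[OF bil] by force
  obtain E where E: "orthonormal_basis g E"
    using orthonormal_basis_exists[OF g] by blast
  define K where "K u v w = (Dg u v w + Dg v u w - Dg w u v) / 2" for u v w
  define \<Gamma> where "\<Gamma> u v = (\<Sum>j\<in>UNIV. K u v (E j) *\<^sub>R E j)" for u v
  have D_lin: "linear (\<lambda>v. Dg u v w)" "linear (\<lambda>w. Dg u v w)" for u v w
    using D(1)[of u] by (auto simp: bilinear_def)
  note add = D_lin(1)[THEN linear_add] D_lin(2)[THEN linear_add] D(3)[THEN linear_add]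
  note scale = D_lin(1)[THEN linear_scale] D_lin(2)[THEN linear_scale] D(3)[THEN linear_scale]
  have K_lin: "linear (K u v)" "linear (\<lambda>v. K u v w)" "linear (\<lambda>u. K u v w)" for u v w
    unfolding K_def
    by (rule linearI; simp only: add scale real_scaleR_def; simp add: field_simps)+
  have g\<Gamma>: "g (\<Gamma> u v) w = K u v w" for u v w
  proof -
    have lin: "linear (\<lambda>z. g z w)"
      using bil by (simp add: bilinear_def)
    have "g (\<Gamma> u v) w = (\<Sum>j\<in>UNIV. K u v (E j) * g (E j) w)"
      by (simp add: \<Gamma>_def linear_sum[OF lin] bilinear_lmul[OF bil])
    also have "\<dots> = K u v (\<Sum>j\<in>UNIV. g w (E j) *\<^sub>R E j)"
      by (simp add: linear_sum[OF K_lin(1)] linear_scale[OF K_lin(1)] sym[of _ w] mult.commute)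
    finally show ?thesis
      using orthonormal_coords[OF g E, of w] by simp
  qed
  have "bilinear \<Gamma>"
    unfolding bilinear_def \<Gamma>_def
    by (intro conjI allI linearI;
        simp only: K_lin[THEN linear_add] K_lin[THEN linear_scale] real_scaleR_def;
        simp add: scaleR_add_left sum.distrib scaleR_sum_right)
  moreover have "\<Gamma> u v = \<Gamma> v u" for u v
    unfolding \<Gamma>_def K_def using D(2) by (simp add: add.commute)
  moreover have "Dg u v w = g (\<Gamma> u v) w + g v (\<Gamma> u w)" for u v w
  proof -
    have "Dg u v w = K u v w + K u w v"
      unfolding K_def using D(2)[of u v w] D(2)[of v u w] D(2)[of w u v]
      by (simp add: field_simps)
    then show ?thesis
      by (simp add: g\<Gamma> sym[of v])
  qed
  ultimately have ex: "levi_civita_coeff g Dg \<Gamma>"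
    by (simp add: levi_civita_coeff_def)
  show ?thesis
  proof (rule ex1I[of _ \<Gamma>])
    fix \<Gamma>' assume L: "levi_civita_coeff g Dg \<Gamma>'"
    have S: "\<Gamma>' u v = \<Gamma>' v u" and m: "Dg u v w = g (\<Gamma>' u v) w + g (\<Gamma>' u w) v" for u v w
      using L sym[of v "\<Gamma>' u w"] by (auto simp: levi_civita_coeff_def)
    have "g (\<Gamma>' u v) w = K u v w" for u v w
      unfolding K_def using m[of u v w] m[of v u w] m[of w u v] S[of u v] S[of u w] S[of v w]
      by simp
    then show "\<Gamma>' = \<Gamma>"
      using g\<Gamma> nondeg by (intro ext) metis
  qed (rule ex)
qed

end

theory Submission
  imports "Jordan_Normal_Form.Determinant" Defs
begin

text \<open>
  For an invertible \<open>A : V \<rightarrow> W\<close>, the map \<open>Z = Cof A\<close> is characterised by the identity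
  \<open>\<langle>A u, Z v\<rangle> = J \<langle>u, v\<rangle>\<close> for all \<open>u\<close>, \<open>v\<close>, where \<open>J\<close> is the factor by which \<open>A\<close> changes oriented
  volume: applying the top exterior power of \<open>A\<close> to \<open>u \<and> \<star>v = \<langle>u, v\<rangle> vol\<^sub>V\<close> gives
  \<open>J \<langle>u, v\<rangle> vol\<^sub>W\<close>, and \<open>Z v\<close> is the vector whose dual is the image of \<open>\<star>v\<close>. In components, \<open>J = \<plusminus> det A \<surd>(det H) / \<surd>(det G)\<close> with the Gram matrices
  \<open>G\<close>, \<open>H\<close> of the two metrics (lemma \<open>Cof_adjoint\<close>).

  For \<open>A = df\<close>, let \<open>B(w, u) = (\<nabla>\<^sub>w df) u\<close> be the second fundamental form of \<open>f\<close>. It is symmetric,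
  because second derivatives commute and both Levi-Civita connections are torsion-free. Since
  both connections are metric, differentiating the identity in direction \<open>w\<close> gives
  \<open>\<langle>A u, (\<nabla>\<^sub>w Z) v\<rangle> = (\<partial>\<^sub>w J) \<langle>u, v\<rangle> - \<langle>B(w, u), Z v\<rangle>\<close>,
  and Jacobi's formula for the three determinants in \<open>J\<close> gives
  \<open>\<partial>\<^sub>w J = J tr (A\<^sup>-\<^sup>1 B(w, \<cdot>)) = \<Sum>\<^sub>j \<langle>B(w, E\<^sub>j), Z E\<^sub>j\<rangle>\<close> for an orthonormal basis \<open>(E\<^sub>j)\<close>.
  Put \<open>w = v = E\<^sub>i\<close> and sum over \<open>i\<close>: the first term becomes \<open>\<Sum>\<^sub>j \<langle>B(u, E\<^sub>j), Z E\<^sub>j\<rangle>\<close> and the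
  second one \<open>\<Sum>\<^sub>i \<langle>B(E\<^sub>i, u), Z E\<^sub>i\<rangle>\<close>. By the symmetry of \<open>B\<close> they cancel, so
  the trace \<open>\<Sum>\<^sub>i (\<nabla>Z)(E\<^sub>i, E\<^sub>i)\<close> is orthogonal to the image of \<open>A\<close>, which is everything. This computation is
  lemma \<open>divergence_eq_0_of_adjoint_identity\<close>; the theorem applies it in a pair of charts.

  At a boundary point all derivatives are one-sided. The half-space contains a segment in each
  coordinate direction at each of its points, so these derivatives are unique, and the second
  derivatives commute because they agree with those of a smooth extension.
\<close>

no_notation Matrix.vec_index (infixl \<open>$\<close> 100)
no_notation Matrix.scalar_prod (infix \<open>\<bullet>\<close> 70)
no_notation Matrix.mult_mat_vec (infixl \<open>*\<^sub>v\<close> 70)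

section \<open>Coordinates of products of vectors\<close>

abbreviation elems :: "'d::{finite,linorder} set \<Rightarrow> 'd list" where
  "elems \<equiv> sorted_list_of_set"

lemma card_below_nth_elems:
  fixes S :: "'d::{finite,linorder} set"
  assumes "j < card S"
  shows "card {u \<in> S. u < elems S ! j} = j"
proof -
  let ?ts = "elems S"
  have ts: "sorted ?ts" "distinct ?ts" "set ?ts = S" "length ?ts = card S" by auto
  have lt: "?ts ! k < ?ts ! j \<longleftrightarrow> k < j" if "k < card S" for k
    by (metis assms linorder_less_linear order_less_asym sorted_wrt_nth_less
        strict_sorted_list_of_set that ts(4))
  have "{u \<in> S. u < ?ts ! j} = (\<lambda>k. ?ts ! k) ` {..<j}"
  proof (intro equalityI subsetI)
    fix u assume "u \<in> {u \<in> S. u < ?ts ! j}"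
    then obtain k where "k < card S" "u = ?ts ! k" "u < ?ts ! j"
      using ts by (metis (mono_tags, lifting) in_set_conv_nth mem_Collect_eq)
    then show "u \<in> (\<lambda>k. ?ts ! k) ` {..<j}" using lt by auto
  next
    fix u assume "u \<in> (\<lambda>k. ?ts ! k) ` {..<j}"
    then show "u \<in> {u \<in> S. u < ?ts ! j}"
      using assms lt ts nth_mem[of _ ?ts] by fastforce
  qed
  moreover have "inj_on (\<lambda>k. ?ts ! k) {..<j}"
    using assms ts by (auto simp: inj_on_def nth_eq_iff_index_eq)
  ultimately show ?thesis by (simp add: card_image)
qed

lemma nth_elems_delete:
  fixes S :: "'d::{finite,linorder} set"
  assumes "j < card S" "k < card S - 1"
  shows "elems (S - {elems S ! j}) ! k = elems S ! (if k < j then k else Suc k)"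
proof -
  let ?ts = "elems S"
  have ts: "distinct ?ts" "length ?ts = card S" by auto
  have "elems (S - {?ts ! j}) = remove1 (?ts ! j) ?ts"
    by (simp add: sorted_list_of_set_remove)
  also have "\<dots> = take j ?ts @ drop (Suc j) ?ts"
  proof -
    have "?ts ! j \<notin> set (take j ?ts)"
      using assms(1) ts by (auto simp: in_set_conv_nth nth_eq_iff_index_eq)
    then have "remove1 (?ts ! j) (take j ?ts @ ?ts ! j # drop (Suc j) ?ts) = take j ?ts @ drop (Suc j) ?ts"
      by (simp add: remove1_append)
    then show ?thesis using assms(1) ts by (simp flip: id_take_nth_drop)
  qed
  finally show ?thesis
    using assms ts by (auto simp: nth_append)
qed

lemma shuffle_sign_singleton:
  fixes S :: "'d::{finite,linorder} set"
  shows "shuffle_sign {i} (S - {i}) = (-1) ^ card {u \<in> S. u < i}"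
proof -
  have "{(t, u). t \<in> {i} \<and> u \<in> S - {i} \<and> u < t} = Pair i ` {u \<in> S. u < i}" by auto
  then show ?thesis unfolding shuffle_sign_def by (simp only:) (simp add: card_image inj_on_def)
qed

lemma wedge_vec_coeff:
  fixes v :: "'d::{finite,linorder} rvec"
  shows "wedge (vec_to_ext v) \<beta> $ S
    = (\<Sum>i\<in>S. (-1) ^ card {u \<in> S. u < i} * v $ i * \<beta> $ (S - {i}))"
proof -
  have "wedge (vec_to_ext v) \<beta> $ S = (\<Sum>T\<in>Pow S. \<Sum>i\<in>UNIV.
      if T = {i} then shuffle_sign {i} (S - {i}) * v $ i * \<beta> $ (S - {i}) else 0)"
    by (auto simp: wedge_def vec_to_ext_def sum_distrib_left sum_distrib_right intro!: sum.cong)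
  also have "\<dots> = (\<Sum>i\<in>UNIV. \<Sum>T\<in>Pow S.
      if T = {i} then shuffle_sign {i} (S - {i}) * v $ i * \<beta> $ (S - {i}) else 0)"
    by (rule sum.swap)
  also have "\<dots> = (\<Sum>i\<in>UNIV. if i \<in> S then shuffle_sign {i} (S - {i}) * v $ i * \<beta> $ (S - {i}) else 0)"
    by (intro sum.cong) auto
  also have "\<dots> = (\<Sum>i\<in>S. shuffle_sign {i} (S - {i}) * v $ i * \<beta> $ (S - {i}))"
    by (simp add: sum.If_cases)
  finally show ?thesis by (simp add: shuffle_sign_singleton)
qed

lemma wedge_list_coeff_0:
  fixes vs :: "('d::{finite,linorder} rvec) list"
  assumes "card S \<noteq> length vs"
  shows "wedge_list vs $ S = 0"
  using assms
proof (induction vs arbitrary: S)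
  case Nil
  then show ?case by (auto simp: wedge_list_def axis_def)
next
  case (Cons v vs)
  have "wedge_list vs $ (S - {i}) = 0" if "i \<in> S" for i
    proof (rule Cons.IH)
    have "card S = Suc (card (S - {i}))"
      using that by (metis card_Suc_Diff1 finite_code)
    then show "card (S - {i}) \<noteq> length vs" using Cons.prems by simp
  qed
  then show ?case
    by (simp add: wedge_list_def wedge_vec_coeff)
qed

text \<open>
  Wedging with a vector from the left is Laplace expansion along the first row: the coefficient of
  a product of vectors at \<open>e\<^sub>S\<close> is the minor of their matrix on the columns in \<open>S\<close>.
\<close>

lemma wedge_list_coeff:
  fixes vs :: "('d::{finite,linorder} rvec) list"
  assumes "card S = length vs"
  shows "wedge_list vs $ S
    = Determinant.det (Matrix.mat (length vs) (length vs) (\<lambda>(i, j). vs ! i $ (elems S ! j)))"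
  using assms
proof (induction vs arbitrary: S)
  case Nil
  then have "S = {}" by simp
  then show ?case by (simp add: wedge_list_def axis_def)
next
  case (Cons v vs)
  let ?n = "length (v # vs)" and ?ts = "elems S"
  let ?M = "Matrix.mat ?n ?n (\<lambda>(i, j). (v # vs) ! i $ (?ts ! j))"
  have ts: "distinct ?ts" "set ?ts = S" "length ?ts = ?n" using Cons.prems by auto
  have "wedge_list (v # vs) $ S
      = (\<Sum>i\<in>S. (-1) ^ card {u \<in> S. u < i} * v $ i * wedge_list vs $ (S - {i}))"
    by (simp add: wedge_list_def wedge_vec_coeff)
  also have "\<dots> = (\<Sum>j<?n. (-1) ^ card {u \<in> S. u < ?ts ! j} * v $ (?ts ! j) * wedge_list vs $ (S - {?ts ! j}))"
    using bij_betw_nth[OF ts(1) refl ts(2)[symmetric]] ts(3)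
    by (intro sum.reindex_bij_betw[symmetric]) simp
  also have "\<dots> = (\<Sum>j<?n. ?M $$ (0, j) * cofactor ?M 0 j)"
  proof (rule sum.cong[OF refl])
    fix j assume "j \<in> {..<?n}"
    then have j: "j < card S" using Cons.prems by simp
    have mem: "?ts ! j \<in> S" using j ts Cons.prems by (metis nth_mem)
    have "wedge_list vs $ (S - {?ts ! j}) = Determinant.det
        (Matrix.mat (length vs) (length vs) (\<lambda>(i, k). vs ! i $ (elems (S - {?ts ! j}) ! k)))"
      using mem Cons.prems by (intro Cons.IH) (simp add: card_Diff_singleton)
    also have "Matrix.mat (length vs) (length vs) (\<lambda>(i, k). vs ! i $ (elems (S - {?ts ! j}) ! k))
        = mat_delete ?M 0 j"
      using j Cons.prems by (intro eq_matI) (auto simp: mat_delete_def nth_elems_delete)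
    finally show "(-1) ^ card {u \<in> S. u < ?ts ! j} * v $ (?ts ! j) * wedge_list vs $ (S - {?ts ! j})
        = ?M $$ (0, j) * cofactor ?M 0 j"
      using j Cons.prems by (simp add: card_below_nth_elems cofactor_def)
  qed
  also have "\<dots> = Determinant.det ?M"
    by (rule laplace_expansion_row[symmetric]) auto
  finally show ?case .
qed

section \<open>Laplace expansion\<close>

lemma permutes_lt: "p permutes {0..<n::nat} \<Longrightarrow> i < n \<Longrightarrow> p i < n"
  using permutes_in_image[of p "{0..<n}" i] by simp

text \<open>
  Numbering the index type in increasing order turns a determinant over the type into one over
  \<open>{0..<CARD('d)}\<close>. Minors have no index type of their own, so Laplace expansion takes place there.
\<close>

lemma det_reindex:
  fixes f :: "'d::{finite,linorder} \<Rightarrow> 'd \<Rightarrow> real"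
  shows "Determinant.det (Matrix.mat CARD('d) CARD('d) (\<lambda>(i, j). f (elems UNIV ! i) (elems UNIV ! j)))
    = det (\<chi> i j. f i j)"
proof -
  let ?N = "{0..<CARD('d)}" and ?u = "\<lambda>k. elems (UNIV :: 'd set) ! k"
  have bij: "bij_betw ?u ?N UNIV"
    using bij_betw_nth[of "elems (UNIV :: 'd set)" ?N UNIV] by (auto simp: atLeast0LessThan)
  then have inj: "inj_on ?u ?N" by (simp add: bij_betw_def)
  have inv: "inv_into ?N ?u (?u k) = k" if "k < CARD('d)" for k
    using inj that by (simp add: inv_into_f_f)
  have inv_u: "?u (inv_into ?N ?u x) = x" for x
    using bij by (metis UNIV_I bij_betw_inv_into_right)
  have bij': "bij_betw (inv_into ?N ?u) UNIV ?N"
    using bij by (rule bij_betw_inv_into)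
  have "Determinant.det (Matrix.mat CARD('d) CARD('d) (\<lambda>(i, j). f (?u i) (?u j)))
      = (\<Sum>p | p permutes ?N. signof p * (\<Prod>i\<in>?N. f (?u i) (?u (p i))))"
    by (simp add: Determinant.det_def cong: prod.cong) (auto simp: permutes_lt intro!: sum.cong prod.cong)
  also have "\<dots> = (\<Sum>p | p permutes (UNIV :: 'd set). of_int (sign p) * (\<Prod>i\<in>UNIV. f i (p i)))"
  proof (rule sum.reindex_bij_witness[where
        j = "map_permutation ?N ?u" and i = "map_permutation UNIV (inv_into ?N ?u)"])
    fix p assume "p \<in> {p. p permutes ?N}"
    then have p: "p permutes ?N" by simp
    show "map_permutation UNIV (inv_into ?N ?u) (map_permutation ?N ?u p) = p"
      by (rule map_permutation_compose_inv[OF bij p]) (simp add: inv)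
    show "map_permutation ?N ?u p \<in> {p. p permutes UNIV}"
      using map_permutation_permutes[OF bij p] by simp
    have "(\<Prod>i\<in>UNIV. f i (map_permutation ?N ?u p i))
        = (\<Prod>i\<in>?N. f (?u i) (map_permutation ?N ?u p (?u i)))"
      using bij by (rule prod.reindex_bij_betw[symmetric])
    also have "\<dots> = (\<Prod>i\<in>?N. f (?u i) (?u (p i)))"
      by (intro prod.cong refl) (simp add: map_permutation_apply[OF inj])
    finally show "of_int (sign (map_permutation ?N ?u p)) * (\<Prod>i\<in>UNIV. f i (map_permutation ?N ?u p i))
        = signof p * (\<Prod>i\<in>?N. f (?u i) (?u (p i)))"
      by (simp add: sign_map_permutation[OF inj p])
  next
    fix p assume "p \<in> {p. p permutes (UNIV :: 'd set)}"
    then have p: "p permutes (UNIV :: 'd set)" by simp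
    show "map_permutation ?N ?u (map_permutation UNIV (inv_into ?N ?u) p) = p"
      by (rule map_permutation_compose_inv[OF bij' p]) (simp add: inv_u)
    show "map_permutation UNIV (inv_into ?N ?u) p \<in> {p. p permutes ?N}"
      using map_permutation_permutes[OF bij' p] by simp
  qed
  also have "\<dots> = det (\<chi> i j. f i j)"
    by (simp add: Determinants.det_def)
  finally show ?thesis .
qed

lemma gram_det_eq_det:
  assumes "length ws = length vs"
  shows "gram_det g vs ws
    = Determinant.det (Matrix.mat (length vs) (length vs) (\<lambda>(i, j). g (vs ! i) (ws ! j)))"
  using assms by (auto simp: gram_det_def Determinant.det_def permutes_lt atLeast0LessThan
      intro!: sum.cong prod.cong)

definition minor :: "('d::{finite,linorder} \<Rightarrow> 'd \<Rightarrow> real) \<Rightarrow> 'd \<Rightarrow> 'd \<Rightarrow> real" where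
  "minor f i j = Determinant.det (Matrix.mat (CARD('d) - 1) (CARD('d) - 1)
     (\<lambda>(a, b). f (elems (- {i}) ! a) (elems (- {j}) ! b)))"

text \<open>
  The sign \<open>(-1)\<^sup>i\<close> of the usual checkerboard, with \<open>i\<close> replaced by its position in the order.
\<close>

definition rank_sign :: "'d::{finite,linorder} \<Rightarrow> real" where
  "rank_sign i = (-1) ^ card {u. u < i}"

lemma rank_sign_square [simp]: "rank_sign i * rank_sign i = 1"
  by (simp add: rank_sign_def flip: power_mult_distrib)

definition cofac :: "('d::{finite,linorder} \<Rightarrow> 'd \<Rightarrow> real) \<Rightarrow> 'd \<Rightarrow> 'd \<Rightarrow> real" where
  "cofac f i j = rank_sign i * rank_sign j * minor f i j"

lemma cofac_eq_cofactor:
  fixes f :: "'d::{finite,linorder} \<Rightarrow> 'd \<Rightarrow> real"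
  assumes "a < CARD('d)" "b < CARD('d)"
  shows "cofac f (elems UNIV ! a) (elems UNIV ! b) = cofactor
    (Matrix.mat CARD('d) CARD('d) (\<lambda>(i, j). f (elems UNIV ! i) (elems UNIV ! j))) a b"
proof -
  have "Matrix.mat (CARD('d) - 1) (CARD('d) - 1)
      (\<lambda>(k, l). f (elems (- {elems UNIV ! a}) ! k) (elems (- {elems UNIV ! b}) ! l))
    = mat_delete (Matrix.mat CARD('d) CARD('d) (\<lambda>(i, j). f (elems UNIV ! i) (elems UNIV ! j))) a b"
    using assms by (intro eq_matI) (auto simp: mat_delete_def nth_elems_delete Compl_eq_Diff_UNIV)
  then show ?thesis
    using assms card_below_nth_elems[of a "UNIV :: 'd set"] card_below_nth_elems[of b "UNIV :: 'd set"]
    by (simp add: cofac_def rank_sign_def cofactor_def minor_def power_add)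
qed

text \<open>
  These are the identities \<open>A adj(A) = adj(A) A = det(A) I\<close>, transported along the order
  isomorphism of the index type with \<open>{0..<CARD('d)}\<close>.
\<close>

lemma sum_cofac:
  fixes f :: "'d::{finite,linorder} \<Rightarrow> 'd \<Rightarrow> real"
  shows "(\<Sum>k\<in>UNIV. f i k * cofac f j k) = (if i = j then det (\<chi> i j. f i j) else 0)" (is ?row)
    and "(\<Sum>k\<in>UNIV. f k i * cofac f k j) = (if i = j then det (\<chi> i j. f i j) else 0)" (is ?col)
proof -
  let ?d = "CARD('d)" and ?u = "\<lambda>k. elems (UNIV :: 'd set) ! k"
  define M where "M = Matrix.mat ?d ?d (\<lambda>(i, j). f (?u i) (?u j))"
  have bij: "bij_betw ?u {0..<?d} UNIV"
    using bij_betw_nth[of "elems (UNIV :: 'd set)" "{0..<?d}" UNIV] by (auto simp: atLeast0LessThan)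
  have "\<exists>a<?d. x = ?u a" for x
    using bij_betw_imp_surj_on[OF bij] by (metis UNIV_I atLeastLessThan_iff imageE)
  then obtain a b where ab: "a < ?d" "b < ?d" "i = ?u a" "j = ?u b"
    by blast
  have ij: "?u a = ?u b \<longleftrightarrow> a = b"
    using ab(1,2) bij by (auto simp: bij_betw_def inj_on_def)
  have M: "M \<in> carrier_mat ?d ?d" by (simp add: M_def)
  have dim: "dim_row M = ?d" "dim_col M = ?d" using M by auto
  have D: "Determinant.det M = det (\<chi> i j. f i j)"
    unfolding M_def by (rule det_reindex)
  have M_nth: "M $$ (k, l) = f (?u k) (?u l)" if "k < ?d" "l < ?d" for k l
    using that by (simp add: M_def)
  have cof: "cofac f (?u k) (?u l) = cofactor M k l" if "k < ?d" "l < ?d" for k l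
    unfolding M_def using that by (rule cofac_eq_cofactor)
  have "(\<Sum>k\<in>UNIV. f i k * cofac f j k) = (\<Sum>k\<in>{0..<?d}. f i (?u k) * cofac f j (?u k))"
    using bij by (rule sum.reindex_bij_betw[symmetric])
  also have "\<dots> = (M * adj_mat M) $$ (a, b)"
    using ab by (simp add: adj_mat_def scalar_prod_def cof M_nth dim)
  also have "\<dots> = (if i = j then det (\<chi> i j. f i j) else 0)"
    using ab by (simp add: adj_mat(2)[OF M] D ij)
  finally show ?row .
  have "(\<Sum>k\<in>UNIV. f k i * cofac f k j) = (\<Sum>k\<in>{0..<?d}. f (?u k) i * cofac f (?u k) j)"
    using bij by (rule sum.reindex_bij_betw[symmetric])
  also have "\<dots> = (adj_mat M * M) $$ (b, a)"
    using ab by (simp add: adj_mat_def scalar_prod_def cof M_nth dim mult.commute)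
  also have "\<dots> = (if i = j then det (\<chi> i j. f i j) else 0)"
    using ab by (auto simp: adj_mat(3)[OF M] D ij)
  finally show ?col .
qed

section \<open>Gram matrices and orthonormal bases\<close>

definition gram_matrix :: "('d::finite rvec \<Rightarrow> 'd rvec \<Rightarrow> real) \<Rightarrow> real^'d^'d" where
  "gram_matrix g = (\<chi> i j. g (axis i 1) (axis j 1))"

lemma vec_expansion:
  fixes u :: "'d::finite rvec"
  shows "(\<Sum>i\<in>UNIV. u $ i *\<^sub>R axis i 1) = u"
  by (simp add: vec_eq_iff axis_def if_distrib[where f = "\<lambda>x. _ * x"] cong: if_cong)

lemma bilinear_eq_sum_axis:
  fixes g :: "'d::finite rvec \<Rightarrow> 'd rvec \<Rightarrow> 'w::real_vector"
  assumes "bilinear g"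
  shows "g u v = (\<Sum>i\<in>UNIV. \<Sum>j\<in>UNIV. (u $ i * v $ j) *\<^sub>R g (axis i 1) (axis j 1))"
proof -
  have "g u v = g (\<Sum>i\<in>UNIV. u $ i *\<^sub>R axis i 1) (\<Sum>j\<in>UNIV. v $ j *\<^sub>R axis j 1)"
    by (simp add: vec_expansion)
  also have "\<dots> = (\<Sum>(i, j)\<in>UNIV \<times> UNIV. g (u $ i *\<^sub>R axis i 1) (v $ j *\<^sub>R axis j 1))"
    by (rule bilinear_sum[OF assms])
  finally show ?thesis
    by (simp add: sum.cartesian_product bilinear_lmul[OF assms] bilinear_rmul[OF assms]
        case_prod_unfold mult.commute)
qed

lemma linear_eq_sum_axis:
  fixes A :: "'d::finite rvec \<Rightarrow> 'w::real_vector"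
  assumes "linear A"
  shows "A u = (\<Sum>i\<in>UNIV. u $ i *\<^sub>R A (axis i 1))"
proof -
  have "A u = A (\<Sum>i\<in>UNIV. u $ i *\<^sub>R axis i 1)"
    by (simp add: vec_expansion)
  then show ?thesis
    by (simp add: linear_sum[OF assms] linear_scale[OF assms])
qed

text \<open>
  The Gram matrix of \<open>g\<close> in the basis \<open>E\<close> is the identity.
\<close>

lemma det_orthonormal_basis:
  fixes E :: "'d::finite \<Rightarrow> 'd rvec"
  assumes g: "bilinear g" and E: "orthonormal_basis g E"
  shows "(det (\<chi> i j. E j $ i))\<^sup>2 * det (gram_matrix g) = 1"
proof -
  let ?E = "\<chi> i j. E j $ i"
  have "(transpose ?E ** gram_matrix g ** ?E) $ i $ j = g (E i) (E j)" for i j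
    unfolding bilinear_eq_sum_axis[OF g, of "E i" "E j"] matrix_matrix_mult_def
      transpose_def gram_matrix_def
    by (subst sum.swap) (simp add: sum_distrib_left sum_distrib_right mult_ac)
  then have "transpose ?E ** gram_matrix g ** ?E = mat 1"
    using E by (simp add: orthonormal_basis_def mat_def vec_eq_iff)
  then have "det (transpose ?E ** gram_matrix g ** ?E) = 1"
    by simp
  then show ?thesis
    by (simp add: det_mul det_transpose power2_eq_square mult_ac)
qed

lemma det_gram_matrix_pos:
  assumes "inner_product g"
  shows "det (gram_matrix g) > 0"
proof -
  obtain E where "orthonormal_basis g E"
    using orthonormal_basis_exists[OF assms] by blast
  then have "(det (\<chi> i j. E j $ i))\<^sup>2 * det (gram_matrix g) = 1"
    using det_orthonormal_basis assms by (auto simp: inner_product_def)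
  then show ?thesis
    by (metis less_numeral_extra(1) linorder_not_le mult_nonneg_nonpos zero_le_power2)
qed

text \<open>
  All positively oriented orthonormal bases have the same determinant, so they define the same
  volume element. This makes the condition on every such basis in the Hodge star consistent.
\<close>

lemma det_pos_orthonormal_basis:
  assumes g: "inner_product g" and s: "s \<in> {1, -1}" and E: "pos_orthonormal_basis g s E"
  shows "det (\<chi> i j. E j $ i) = s / sqrt (det (gram_matrix g))"
proof -
  let ?D = "det (\<chi> i j. E j $ i)" and ?G = "det (gram_matrix g)"
  have G: "?G > 0" by (rule det_gram_matrix_pos[OF g])
  have "?D\<^sup>2 * ?G = 1" and pos: "s * ?D > 0"
    using E g det_orthonormal_basis[of g E]
    by (auto simp: pos_orthonormal_basis_def inner_product_def)
  then have "(s * ?D)\<^sup>2 = 1 / ?G"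
    using G s by (auto simp: power_mult_distrib field_simps)
  then have "s * ?D = sqrt (1 / ?G)"
    using pos by (metis less_imp_le real_sqrt_unique)
  then show ?thesis
    using s by (auto simp: real_sqrt_divide)
qed

text \<open>
  Reversing one vector of an orthonormal basis reverses its orientation.
\<close>

lemma pos_orthonormal_basis_exists:
  fixes g :: "'d::finite rvec \<Rightarrow> 'd rvec \<Rightarrow> real"
  assumes g: "inner_product g" and s: "s \<in> {1, -1}"
  shows "\<exists>E. pos_orthonormal_basis g s E"
proof -
  have bil: "bilinear g" using g by (simp add: inner_product_def)
  obtain E where E: "orthonormal_basis g E"
    using orthonormal_basis_exists[OF g] by blast
  fix a :: 'd
  define E' where "E' = E(a := - E a)"
  have E': "orthonormal_basis g E'"
    using E by (auto simp: orthonormal_basis_def E'_def bilinear_lneg[OF bil] bilinear_rneg[OF bil])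
  have "det (\<chi> i j. E' j $ i) = det (\<chi> i. if i = a then (-1) *s E i else E i)"
    by (subst det_transpose[symmetric]) (auto simp: transpose_def E'_def vec_eq_iff
        intro!: arg_cong[where f = det])
  also have "\<dots> = - det (\<chi> i. if i = a then E i else E i)"
    by (subst det_row_mul) simp
  also have "\<dots> = - det (\<chi> i j. E j $ i)"
    by (subst (2) det_transpose[symmetric]) (auto simp: transpose_def vec_eq_iff
        intro!: arg_cong[where f = det])
  finally have "det (\<chi> i j. E' j $ i) = - det (\<chi> i j. E j $ i)" .
  moreover have "det (\<chi> i j. E j $ i) \<noteq> 0"
    using det_orthonormal_basis[OF bil E] by auto
  ultimately have "s * det (\<chi> i j. E j $ i) > 0 \<or> s * det (\<chi> i j. E' j $ i) > 0"
    using s by auto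
  then show ?thesis
    using E E' by (auto simp: pos_orthonormal_basis_def)
qed

section \<open>The Hodge star in coordinates\<close>

text \<open>
  A product of \<open>CARD('d)\<close> vectors has a single coefficient, at \<open>e\<^bsub>UNIV\<^esub>\<close>, and this is their
  determinant.
\<close>

lemma wedge_list_basis:
  fixes E :: "'d::{finite,linorder} \<Rightarrow> 'd rvec"
  shows "wedge_list (map E (elems UNIV)) = axis UNIV (det (\<chi> i j. E j $ i))"
proof -
  have top: "wedge_list (map E (elems UNIV)) $ UNIV = det (\<chi> i j. E j $ i)"
  proof -
    have "wedge_list (map E (elems UNIV)) $ UNIV
        = Determinant.det (Matrix.mat CARD('d) CARD('d) (\<lambda>(i, j). E (elems UNIV ! i) $ (elems UNIV ! j)))"
      by (subst wedge_list_coeff) (auto intro!: arg_cong[where f = Determinant.det] eq_matI)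
    also have "\<dots> = det (\<chi> i j. E i $ j)"
      by (rule det_reindex)
    also have "\<dots> = det (\<chi> i j. E j $ i)"
      by (subst det_transpose[symmetric]) (simp add: transpose_def)
    finally show ?thesis .
  qed
  have "wedge_list (map E (elems UNIV)) $ S = 0" if "S \<noteq> UNIV" for S
    using that by (intro wedge_list_coeff_0) (auto dest: card_eq_UNIV_imp_eq_UNIV[OF finite])
  with top show ?thesis
    by (auto simp: vec_eq_iff axis_def)
qed

lemma ext_inner_axis:
  "ext_inner g (axis S 1) \<beta> = (\<Sum>T | card T = card S. \<beta> $ T *
     gram_det g (map (\<lambda>i. axis i 1) (elems S)) (map (\<lambda>i. axis i 1) (elems T)))"
proof -
  have "ext_inner g (axis S 1) \<beta> = (\<Sum>S'\<in>UNIV. if S' = S then (\<Sum>T | card T = card S. \<beta> $ T *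
     gram_det g (map (\<lambda>i. axis i 1) (elems S)) (map (\<lambda>i. axis i 1) (elems T))) else 0)"
    unfolding ext_inner_def by (intro sum.cong) (auto simp: axis_def)
  then show ?thesis by simp
qed

lemma ext_inner_eq_sum_axis:
  "ext_inner g \<alpha> \<beta> = (\<Sum>S\<in>UNIV. \<alpha> $ S * ext_inner g (axis S 1) \<beta>)"
  unfolding ext_inner_axis by (simp add: ext_inner_def sum_distrib_left mult_ac)

lemma shuffle_sign_square [simp]: "shuffle_sign T U * shuffle_sign T U = 1"
  by (simp add: shuffle_sign_def flip: power_mult_distrib)

lemma card_Compl_eq_iff:
  fixes U :: "'d::finite set"
  assumes "k \<le> CARD('d)"
  shows "card (- U) = CARD('d) - k \<longleftrightarrow> card U = k"
proof -
  have "card U + card (- U) = CARD('d)"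
    by (metis card_Un_disjoint finite_code Compl_disjoint Compl_partition)
  with assms show ?thesis by linarith
qed

text \<open>
  On complementary degrees the wedge product is, up to signs, the pairing of the coordinates at
  \<open>T\<close> with those at the complement of \<open>T\<close>. It is nondegenerate, and testing the defining equation
  against basis elements reads off each coordinate of the dual. The last factor is the coordinate of
  the volume element.
\<close>

lemma hodge_star_eq:
  fixes g :: "'d::{finite,linorder} rvec \<Rightarrow> 'd rvec \<Rightarrow> real"
  assumes g: "inner_product g" and s: "s \<in> {1, -1}" and k: "k \<le> CARD('d)"
  shows "hodge_star g s k \<beta> = (\<chi> U. if card U = CARD('d) - k
    then shuffle_sign (- U) U * ext_inner g (axis (- U) 1) \<beta> * (s / sqrt (det (gram_matrix g))) else 0)"
proof -
  define c where "c = s / sqrt (det (gram_matrix g))"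
  define \<gamma> :: "'d ext" where "\<gamma> = (\<chi> U. if card U = CARD('d) - k
    then shuffle_sign (- U) U * ext_inner g (axis (- U) 1) \<beta> * c else 0)"
  have vol: "wedge_list (map E (elems UNIV)) = axis UNIV c" if "pos_orthonormal_basis g s E" for E
    using det_pos_orthonormal_basis[OF g s that] by (simp add: wedge_list_basis c_def)
  have "wedge \<alpha> \<gamma> = ext_inner g \<alpha> \<beta> *\<^sub>R axis UNIV c" if \<alpha>: "\<alpha> \<in> ext_power k" for \<alpha>
  proof -
    have "wedge \<alpha> \<gamma> $ S = (ext_inner g \<alpha> \<beta> *\<^sub>R axis UNIV c) $ S" for S
    proof (cases "S = UNIV")
      case True
      have "wedge \<alpha> \<gamma> $ UNIV = (\<Sum>T\<in>UNIV. shuffle_sign T (- T) * \<alpha> $ T * \<gamma> $ (- T))"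
        by (simp add: wedge_def Compl_eq_Diff_UNIV)
      also have "\<dots> = (\<Sum>T\<in>UNIV. \<alpha> $ T * ext_inner g (axis T 1) \<beta> * c)"
      proof (rule sum.cong[OF refl])
        fix T :: "'d set"
        show "shuffle_sign T (- T) * \<alpha> $ T * \<gamma> $ (- T) = \<alpha> $ T * ext_inner g (axis T 1) \<beta> * c"
        proof (cases "card T = k")
          case True
          have "shuffle_sign T (- T) * \<alpha> $ T * \<gamma> $ (- T)
              = (shuffle_sign T (- T) * shuffle_sign T (- T)) * (\<alpha> $ T * ext_inner g (axis T 1) \<beta> * c)"
            using True k by (simp add: \<gamma>_def card_Compl_eq_iff del: shuffle_sign_square)
          then show ?thesis by simp
        next
          case False
          then show ?thesis using \<alpha> by (simp add: ext_power_def)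
        qed
      qed
      also have "\<dots> = ext_inner g \<alpha> \<beta> * c"
        by (subst (2) ext_inner_eq_sum_axis) (simp add: sum_distrib_right)
      finally show ?thesis using True by simp
    next
      case False
      have "shuffle_sign T (S - T) * \<alpha> $ T * \<gamma> $ (S - T) = 0" if "T \<subseteq> S" for T
      proof (rule ccontr)
        assume "shuffle_sign T (S - T) * \<alpha> $ T * \<gamma> $ (S - T) \<noteq> 0"
        then have "card T = k" "card (S - T) = CARD('d) - k"
          using \<alpha> by (auto simp: ext_power_def \<gamma>_def split: if_splits)
        then have "card S = CARD('d)"
          using k that card_mono[OF finite that] by (simp add: card_Diff_subset)
        then show False using False card_eq_UNIV_imp_eq_UNIV[OF finite] by blast
      qed
      then have "wedge \<alpha> \<gamma> $ S = 0"
        unfolding wedge_def by (simp only: vec_lambda_beta) (intro sum.neutral; auto)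
      then show ?thesis using False by (simp add: axis_def)
    qed
    then show ?thesis by (simp only: vec_eq_iff) blast
  qed
  moreover have "\<gamma> \<in> ext_power (CARD('d) - k)"
    by (simp add: ext_power_def \<gamma>_def)
  ultimately have ex: "\<gamma> \<in> ext_power (CARD('d) - k) \<and> (\<forall>\<alpha>\<in>ext_power k. \<forall>E. pos_orthonormal_basis g s E \<longrightarrow>
      wedge \<alpha> \<gamma> = ext_inner g \<alpha> \<beta> *\<^sub>R wedge_list (map E (elems UNIV)))"
    by (auto simp: vol)
  have uniq: "\<delta> = \<gamma>" if \<delta>: "\<delta> \<in> ext_power (CARD('d) - k) \<and> (\<forall>\<alpha>\<in>ext_power k. \<forall>E. pos_orthonormal_basis g s E \<longrightarrow>
      wedge \<alpha> \<delta> = ext_inner g \<alpha> \<beta> *\<^sub>R wedge_list (map E (elems UNIV)))" for \<delta>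
  proof -
    obtain E where E: "pos_orthonormal_basis g s E"
      using pos_orthonormal_basis_exists[OF g s] by blast
    have "\<delta> $ U = \<gamma> $ U" for U
    proof (cases "card U = CARD('d) - k")
      case True
      then have card: "card (- U) = k"
        using card_Compl_eq_iff[of "CARD('d) - k" U] k by simp
      then have "axis (- U) 1 \<in> ext_power k"
        by (auto simp: ext_power_def axis_def)
      then have "wedge (axis (- U) 1) \<delta>
          = ext_inner g (axis (- U) 1) \<beta> *\<^sub>R wedge_list (map E (elems UNIV))"
        using \<delta> E by blast
      then have "wedge (axis (- U) 1) \<delta> $ UNIV = ext_inner g (axis (- U) 1) \<beta> * c"
        unfolding vol[OF E] by simp
      moreover have "wedge (axis (- U) 1) \<delta> $ UNIV
          = (\<Sum>T\<in>UNIV. if T = - U then shuffle_sign (- U) U * \<delta> $ U else 0)"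
        unfolding wedge_def
        by (simp only: vec_lambda_beta Pow_UNIV) (intro sum.cong, auto simp: axis_def Compl_eq_Diff_UNIV[symmetric])
      ultimately have eq: "shuffle_sign (- U) U * \<delta> $ U = ext_inner g (axis (- U) 1) \<beta> * c"
        by simp
      have "\<delta> $ U = shuffle_sign (- U) U * (shuffle_sign (- U) U * \<delta> $ U)"
        by (simp flip: mult.assoc)
      also have "\<dots> = \<gamma> $ U"
        using True by (simp add: eq \<gamma>_def)
      finally show ?thesis .
    next
      case False
      then show ?thesis using \<delta> by (simp add: ext_power_def \<gamma>_def)
    qed
    then show "\<delta> = \<gamma>" by (simp only: vec_eq_iff) blast
  qed
  have "hodge_star g s k \<beta> = \<gamma>"
    unfolding hodge_star_def using ex uniq by (rule the_equality)
  then show ?thesis unfolding \<gamma>_def c_def .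
qed

lemma card_Compl_singleton: "card (- {i :: 'd::finite}) = CARD('d) - 1"
  by (simp add: Compl_eq_Diff_UNIV card_Diff_singleton)

lemma sum_card_1:
  fixes F :: "'d::finite set \<Rightarrow> 'w::comm_monoid_add"
  shows "(\<Sum>T | card T = 1. F T) = (\<Sum>j\<in>UNIV. F {j})"
proof -
  have "{T :: 'd set. card T = 1} = range (\<lambda>j. {j})"
    by (auto simp: card_1_singleton_iff)
  then show ?thesis by (simp add: sum.reindex inj_on_def)
qed

lemma sum_card_codim_1:
  fixes F :: "'d::finite set \<Rightarrow> 'w::comm_monoid_add"
  shows "(\<Sum>T | card T = CARD('d) - 1. F T) = (\<Sum>j\<in>UNIV. F (- {j}))"
proof -
  have "{T :: 'd set. card T = CARD('d) - 1} = uminus ` {T. card T = 1}"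
  proof (intro equalityI subsetI)
    fix T :: "'d set" assume "T \<in> {T. card T = CARD('d) - 1}"
    then have "card (- T) = 1"
      using card_Compl_eq_iff[of 1 "- T"] by (simp add: Suc_le_eq)
    then show "T \<in> uminus ` {T. card T = 1}"
      by (intro image_eqI[of _ _ "- T"]) auto
  qed (auto simp: card_1_singleton_iff card_Compl_singleton)
  then have "(\<Sum>T | card T = CARD('d) - 1. F T) = (\<Sum>T | card T = 1. F (- T))"
    by (simp add: sum.reindex inj_on_def)
  then show ?thesis by (simp only: sum_card_1)
qed

lemma shuffle_sign_singleton_Compl: "shuffle_sign {i} (- {i}) = rank_sign i"
  using shuffle_sign_singleton[of i UNIV] by (simp add: rank_sign_def Compl_eq_Diff_UNIV)

lemma shuffle_sign_Compl_singleton: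
  "(-1) ^ (CARD('d) - 1) * shuffle_sign (- {i}) {i} = rank_sign (i :: 'd::{finite,linorder})"
proof -
  have "{(t, u). t \<in> - {i} \<and> u \<in> {i} \<and> u < t} = (\<lambda>t. (t, i)) ` {t. i < t}" by auto
  then have sh: "shuffle_sign (- {i}) {i} = (-1) ^ card {t. i < t}"
    unfolding shuffle_sign_def by (simp only:) (simp add: card_image inj_on_def)
  have "- {i} = {t. t < i} \<union> {t. i < t}" by auto
  then have "CARD('d) - 1 = card {t. t < i} + card {t. i < t}"
    using card_Un_disjoint[of "{t. t < i}" "{t. i < t}"] card_Compl_singleton[of i]
    by (metis (no_types, lifting) disjoint_iff finite mem_Collect_eq order_less_asym)
  then show ?thesis
    by (simp add: sh rank_sign_def power_add mult.assoc)
qed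

lemma hodge_star_vec:
  fixes g :: "'d::{finite,linorder} rvec \<Rightarrow> 'd rvec \<Rightarrow> real"
  assumes g: "inner_product g" and s: "s \<in> {1, -1}"
  shows "card S \<noteq> CARD('d) - 1 \<Longrightarrow> hodge_star g s 1 (vec_to_ext v) $ S = 0"
    and "hodge_star g s 1 (vec_to_ext v) $ (- {i})
      = rank_sign i * g (axis i 1) v * (s / sqrt (det (gram_matrix g)))"
proof -
  have "bilinear g" using g by (simp add: inner_product_def)
  then have lin: "linear (g (axis i 1))" by (simp add: bilinear_def)
  have star: "hodge_star g s 1 (vec_to_ext v) $ S = (if card S = CARD('d) - 1
    then shuffle_sign (- S) S * ext_inner g (axis (- S) 1) (vec_to_ext v) * (s / sqrt (det (gram_matrix g)))
    else 0)" for S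
    by (subst hodge_star_eq[OF g s]) (auto simp: Suc_le_eq)
  then show "hodge_star g s 1 (vec_to_ext v) $ S = 0" if "card S \<noteq> CARD('d) - 1"
    using that by simp
  have "vec_to_ext v $ {j} = v $ j" for j
    by (simp add: vec_to_ext_def)
  moreover have "gram_det g [a] [b] = g a b" for a b
    by (simp add: gram_det_eq_det det_single)
  ultimately have "ext_inner g (axis {i} 1) (vec_to_ext v) = g (axis i 1) v"
    unfolding ext_inner_axis linear_eq_sum_axis[OF lin, of v]
    by (simp add: sum_card_1[unfolded One_nat_def])
  then show "hodge_star g s 1 (vec_to_ext v) $ (- {i})
      = rank_sign i * g (axis i 1) v * (s / sqrt (det (gram_matrix g)))"
    by (subst star) (simp add: shuffle_sign_singleton_Compl card_Compl_singleton)
qed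

text \<open>
  The inner products of the basis elements of degree \<open>CARD('d) - 1\<close> are the minors of the Gram
  matrix. Together with the shuffle signs, and with the sign \<open>(-1)\<^sup>d\<^sup>-\<^sup>1\<close> of the cofactor, they form
  the cofactor matrix, that is, a multiple of the inverse Gram matrix.
\<close>

lemma hodge_star_codim_1:
  fixes h :: "'d::{finite,linorder} rvec \<Rightarrow> 'd rvec \<Rightarrow> real"
  assumes h: "inner_product h" and t: "t \<in> {1, -1}"
  shows "(-1) ^ (CARD('d) - 1) * hodge_star h t (CARD('d) - 1) \<eta> $ {i}
    = t / sqrt (det (gram_matrix h)) *
      (\<Sum>j\<in>UNIV. rank_sign j * \<eta> $ (- {j}) * cofac (\<lambda>k l. h (axis k 1) (axis l 1)) i j)"
proof -
  let ?f = "\<lambda>k l. h (axis k 1) (axis l 1)"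
  have gram: "gram_det h (map (\<lambda>k. axis k 1) (elems (- {i}))) (map (\<lambda>k. axis k 1) (elems (- {j})))
      = minor ?f i j" for j
    unfolding minor_def by (subst gram_det_eq_det)
      (auto simp: card_Compl_singleton intro!: arg_cong[where f = Determinant.det] eq_matI)
  have "ext_inner h (axis (- {i}) 1) \<eta> = (\<Sum>j\<in>UNIV. \<eta> $ (- {j}) * minor ?f i j)"
    unfolding ext_inner_axis card_Compl_singleton sum_card_codim_1 gram ..
  then have "hodge_star h t (CARD('d) - 1) \<eta> $ {i} = shuffle_sign (- {i}) {i} *
      (\<Sum>j\<in>UNIV. \<eta> $ (- {j}) * minor ?f i j) * (t / sqrt (det (gram_matrix h)))"
    by (subst hodge_star_eq[OF h t]) (auto simp: Suc_le_eq)
  then have "(-1) ^ (CARD('d) - 1) * hodge_star h t (CARD('d) - 1) \<eta> $ {i} = rank_sign i *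
      (\<Sum>j\<in>UNIV. \<eta> $ (- {j}) * minor ?f i j) * (t / sqrt (det (gram_matrix h)))"
    unfolding shuffle_sign_Compl_singleton[symmetric] by simp
  moreover have "rank_sign i * (\<Sum>j\<in>UNIV. \<eta> $ (- {j}) * minor ?f i j)
      = (\<Sum>j\<in>UNIV. rank_sign j * \<eta> $ (- {j}) * cofac ?f i j)"
    unfolding sum_distrib_left
  proof (rule sum.cong[OF refl])
    fix j
    have "rank_sign j * \<eta> $ (- {j}) * cofac ?f i j
        = (rank_sign j * rank_sign j) * (rank_sign i * (\<eta> $ (- {j}) * minor ?f i j))"
      by (simp add: cofac_def del: rank_sign_square)
    then show "rank_sign i * (\<eta> $ (- {j}) * minor ?f i j) = rank_sign j * \<eta> $ (- {j}) * cofac ?f i j"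
      unfolding rank_sign_square mult_1_left by (rule sym)
  qed
  ultimately show ?thesis by (simp add: mult.commute)
qed

section \<open>The cofactor as a multiple of the inverse adjoint\<close>

text \<open>
  The matrix of an exterior power of \<open>A\<close> consists of minors of \<open>A\<close>; in degree \<open>CARD('d) - 1\<close>
  and up to signs it is the cofactor matrix.
\<close>

lemma ext_map_hodge_star_coeff:
  fixes g :: "'d::{finite,linorder} rvec \<Rightarrow> 'd rvec \<Rightarrow> real"
  assumes g: "inner_product g" and s: "s \<in> {1, -1}"
  shows "rank_sign j * ext_map A (hodge_star g s 1 (vec_to_ext v)) $ (- {j})
    = s / sqrt (det (gram_matrix g)) *
      (\<Sum>i\<in>UNIV. g (axis i 1) v * cofac (\<lambda>k l. A (axis k 1) $ l) i j)"
proof -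
  let ?st = "hodge_star g s 1 (vec_to_ext v)" and ?f = "\<lambda>k l. A (axis k 1) $ l"
  have minor: "wedge_list (map (\<lambda>k. A (axis k 1)) (elems (- {i}))) $ (- {j}) = minor ?f i j" for i
    unfolding minor_def by (subst wedge_list_coeff)
      (auto simp: card_Compl_singleton intro!: arg_cong[where f = Determinant.det] eq_matI)
  have "ext_map A ?st $ (- {j})
      = (\<Sum>S\<in>UNIV. ?st $ S * wedge_list (map (\<lambda>k. A (axis k 1)) (elems S)) $ (- {j}))"
    by (simp add: ext_map_def)
  also have "\<dots> = (\<Sum>S | card S = CARD('d) - 1. ?st $ S * wedge_list (map (\<lambda>k. A (axis k 1)) (elems S)) $ (- {j}))"
    by (rule sum.mono_neutral_right) (auto simp: hodge_star_vec(1)[OF g s, unfolded One_nat_def])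
  also have "\<dots> = (\<Sum>i\<in>UNIV. ?st $ (- {i}) * minor ?f i j)"
    by (simp only: sum_card_codim_1 minor)
  finally show ?thesis
    by (simp only: hodge_star_vec(2)[OF g s] cofac_def sum_distrib_left)
      (auto intro!: sum.cong)
qed

text \<open>
  The star of the target contributes the cofactor matrix of its Gram matrix \<open>H\<close>, the exterior
  power that of \<open>A\<close>, and two Laplace expansions collapse these to \<open>det H\<close> and \<open>det A\<close>. The
  factor in front of \<open>g u v\<close> is the ratio of the pulled-back oriented volume to the original one.
\<close>

lemma Cof_adjoint:
  fixes g h :: "'d::{finite,linorder} rvec \<Rightarrow> 'd rvec \<Rightarrow> real"
  assumes g: "inner_product g" and s: "s \<in> {1, -1}"
    and h: "inner_product h" and t: "t \<in> {1, -1}" and A: "linear A"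
  shows "h (A u) (Cof g s h t A v)
    = s * t * det (matrix A) * (sqrt (det (gram_matrix h)) / sqrt (det (gram_matrix g))) * g u v"
proof -
  define a where "a = s / sqrt (det (gram_matrix g))"
  define b where "b = t / sqrt (det (gram_matrix h))"
  define z where "z = Cof g s h t A v"
  define \<eta> where "\<eta> = ext_map A (hodge_star g s 1 (vec_to_ext v))"
  let ?H = "\<lambda>k l. h (axis k 1) (axis l 1)" and ?A = "\<lambda>k l. A (axis k 1) $ l"
  have bil: "bilinear g" "bilinear h" and sym: "\<And>u v. h u v = h v u"
    using g h by (auto simp: inner_product_def)
  have z: "z $ i = b * (\<Sum>j\<in>UNIV. rank_sign j * \<eta> $ (- {j}) * cofac ?H i j)" for i
    using hodge_star_codim_1[OF h t, of \<eta> i]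
    by (simp add: z_def Cof_def ext_to_vec_def \<eta>_def b_def)
  (* Lowering the index of z by h undoes the inverse Gram matrix hidden in the cofactors. *)
  have Hz: "h (axis k 1) z = b * det (gram_matrix h) * (rank_sign k * \<eta> $ (- {k}))" for k
  proof -
    have lin: "linear (h (axis k 1))" using bil by (simp add: bilinear_def)
    have "h (axis k 1) z = (\<Sum>i\<in>UNIV. z $ i * ?H i k)"
      by (subst linear_eq_sum_axis[OF lin]) (simp add: sym[of _ "axis k 1"])
    also have "\<dots> = b * (\<Sum>i\<in>UNIV. \<Sum>j\<in>UNIV. rank_sign j * \<eta> $ (- {j}) * (?H i k * cofac ?H i j))"
      by (simp add: z sum_distrib_left sum_distrib_right mult_ac)
    also have "\<dots> = b * (\<Sum>j\<in>UNIV. rank_sign j * \<eta> $ (- {j}) * (\<Sum>i\<in>UNIV. ?H i k * cofac ?H i j))"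
      by (subst sum.swap) (simp add: sum_distrib_left)
    also have "\<dots> = b * (\<Sum>j\<in>UNIV. rank_sign j * \<eta> $ (- {j}) * (if k = j then det (gram_matrix h) else 0))"
      by (simp only: sum_cofac(2)[of ?H] gram_matrix_def)
    finally show ?thesis by (simp add: if_distrib cong: if_cong)
  qed
  have \<eta>: "rank_sign k * \<eta> $ (- {k}) = a * (\<Sum>i\<in>UNIV. g (axis i 1) v * cofac ?A i k)" for k
    unfolding \<eta>_def a_def by (rule ext_map_hodge_star_coeff[OF g s])
  have detA: "det (\<chi> i j. ?A i j) = det (matrix A)"
    by (subst det_transpose[symmetric]) (simp add: transpose_def matrix_def)
  have Az: "h (A (axis l 1)) z = b * det (gram_matrix h) * a * det (matrix A) * g (axis l 1) v" for l
  proof -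
    have lin: "linear (\<lambda>w. h w z)" using bil by (simp add: bilinear_def)
    have "h (A (axis l 1)) z = (\<Sum>k\<in>UNIV. ?A l k * h (axis k 1) z)"
      by (subst linear_eq_sum_axis[OF lin]) simp
    also have "\<dots> = b * det (gram_matrix h) * a * (\<Sum>k\<in>UNIV. \<Sum>i\<in>UNIV. g (axis i 1) v * (?A l k * cofac ?A i k))"
      by (simp add: Hz \<eta> sum_distrib_left mult_ac)
    also have "\<dots> = b * det (gram_matrix h) * a * (\<Sum>i\<in>UNIV. g (axis i 1) v * (\<Sum>k\<in>UNIV. ?A l k * cofac ?A i k))"
      by (subst sum.swap) (simp add: sum_distrib_left)
    also have "\<dots> = b * det (gram_matrix h) * a * (\<Sum>i\<in>UNIV. g (axis i 1) v * (if l = i then det (matrix A) else 0))"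
      by (simp only: sum_cofac(1)[of ?A] detA)
    finally show ?thesis by (simp add: if_distrib cong: if_cong)
  qed
  have lin: "linear (\<lambda>u. h (A u) z)" "linear (\<lambda>u. g u v)"
    using bil linear_compose[OF A, of "\<lambda>w. h w z"] by (auto simp: bilinear_def o_def)
  have "h (A u) z = b * det (gram_matrix h) * a * det (matrix A) * g u v"
    by (subst linear_eq_sum_axis[OF lin(1)], subst linear_eq_sum_axis[OF lin(2)])
      (simp add: Az sum_distrib_left mult_ac)
  moreover have "b * det (gram_matrix h) = t * sqrt (det (gram_matrix h))"
    using det_gram_matrix_pos[OF h] by (simp add: b_def real_div_sqrt flip: times_divide_eq_right)
  ultimately show ?thesis
    by (simp add: a_def z_def)
qed

section \<open>Derivatives on the half-space\<close>

text \<open>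
  The half-space contains a short segment in the positive coordinate directions at each of its
  points, which determines a one-sided derivative.
\<close>

lemma has_derivative_half_space_unique:
  fixes F :: "'d::{finite,linorder} rvec \<Rightarrow> 'w::real_normed_vector"
  assumes x: "x \<in> half_space"
    and "(F has_derivative D) (at x within half_space)" "(F has_derivative D') (at x within half_space)"
  shows "D = D'"
proof (rule frechet_derivative_unique_within[OF assms(2,3)])
  fix i :: "'d rvec" and e :: real
  assume "i \<in> Basis" "0 < e"
  then obtain k where "i = axis k 1" by (auto simp: Basis_vec_def)
  then have "x + (e / 2) *\<^sub>R i \<in> half_space"
    using x \<open>0 < e\<close> by (auto simp: half_space_def axis_def)
  then show "\<exists>d. 0 < \<bar>d\<bar> \<and> \<bar>d\<bar> < e \<and> x + d *\<^sub>R i \<in> half_space"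
    using \<open>0 < e\<close> by (intro exI[of _ "e / 2"]) auto
qed

lemma hderiv_eq:
  assumes "x \<in> half_space" "(F has_derivative D) (at x within half_space)"
  shows "hderiv F x = D"
  unfolding hderiv_def frechet_derivative_def
  using assms has_derivative_half_space_unique by (intro some_equality) blast+

lemma at_within_openin:
  assumes "openin (top_of_set H) S" "x \<in> S"
  shows "at x within H = at x within S"
proof -
  obtain T where "open T" "S = H \<inter> T"
    using assms(1) by (auto simp: openin_open)
  with assms(2) show ?thesis
    by (intro at_within_nhd[of x T]) auto
qed

lemma smooth_on_subset:
  assumes "smooth_on S F" "T \<subseteq> S"
  shows "smooth_on T F"
  unfolding smooth_on_def
proof
  fix x assume "x \<in> T"
  then have "x \<in> S" using assms(2) by (rule rev_subsetD)
  then obtain U G where *: "open U" "x \<in> U" "\<forall>k. Ck_on k G U" "\<forall>y\<in>S \<inter> U. G y = F y"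
    using assms(1) by (auto simp only: smooth_on_def)
  show "\<exists>U G. open U \<and> x \<in> U \<and> (\<forall>k. Ck_on k G U) \<and> (\<forall>y\<in>T \<inter> U. G y = F y)"
    using * assms(2) by (intro exI[of _ U] exI[of _ G]) (auto simp del: Ck_on.simps)
qed

lemma smooth_on_imp_differentiable:
  assumes "smooth_on S F" "x \<in> S"
  shows "\<exists>D. (F has_derivative D) (at x within S)"
proof -
  obtain U G where U: "open U" "x \<in> U" "\<forall>k. Ck_on k G U" "\<forall>y\<in>S \<inter> U. G y = F y"
    using assms by (auto simp only: smooth_on_def)
  then have "Ck_on (Suc 0) G U" by blast
  then obtain D where "(G has_derivative D) (at x)"
    using U(2) by auto
  then have "(G has_derivative D) (at x within S \<inter> U)"
    by (rule has_derivative_at_withinI)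
  then have "(F has_derivative D) (at x within S \<inter> U)"
    by (rule has_derivative_transform[rotated 2]) (use U assms(2) in auto)
  moreover have "at x within S = at x within S \<inter> U"
    using U(1,2) assms(2) by (intro at_within_openin) auto
  ultimately show ?thesis by metis
qed

lemma smooth_on_has_hderiv:
  assumes "openin (top_of_set half_space) S" "smooth_on S F" "x \<in> S"
  shows "(F has_derivative hderiv F x) (at x within half_space)"
proof -
  have eq: "at x within half_space = at x within S"
    using assms(1,3) by (rule at_within_openin)
  then obtain D where "(F has_derivative D) (at x within half_space)"
    using smooth_on_imp_differentiable[OF assms(2,3)] by auto
  moreover have "x \<in> half_space"
    using assms(1,3) openin_imp_subset by blast
  ultimately show ?thesis
    using hderiv_eq by metis
qed

text \<open>
  The mean value theorem in direction \<open>u\<close>, applied to the increment of \<open>G\<close> in direction \<open>v\<close>,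
  expresses the second difference by a value of \<open>G'\<close> whose first-order expansion at \<open>x\<close> is known.
  The second difference is symmetric in \<open>u\<close> and \<open>v\<close>, which yields the symmetry of second
  derivatives at a point where \<open>G'\<close> is merely differentiable.
\<close>

lemma second_difference_quotient:
  fixes G :: "'v::real_normed_vector \<Rightarrow> real"
  assumes U: "open U" "x \<in> U" and G: "\<And>y. y \<in> U \<Longrightarrow> (G has_derivative G' y) (at y)"
    and D: "((\<lambda>y. G' y u) has_derivative D) (at x)" and e: "e > 0"
  shows "\<exists>\<delta>>0. \<forall>t. 0 < t \<and> t < \<delta> \<longrightarrow>
    \<bar>G (x + t *\<^sub>R u + t *\<^sub>R v) - G (x + t *\<^sub>R u) - G (x + t *\<^sub>R v) + G x - t\<^sup>2 * D v\<bar> \<le> e * t\<^sup>2"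
proof -
  (* Up to the factor t, c bounds the displacements from x; the summand 1 keeps it positive. *)
  define c where "c = norm u + norm v + 1"
  have c: "c > 0" by (simp add: c_def add_nonneg_pos)
  obtain r where r: "r > 0" "ball x r \<subseteq> U"
    using U openE by blast
  have lin: "linear D" using D has_derivative_linear by blast
  obtain \<eta> where \<eta>: "\<eta> > 0" and
    approx: "\<And>y. norm (y - x) < \<eta> \<Longrightarrow> \<bar>G' y u - G' x u - D (y - x)\<bar> \<le> e / (2 * c) * norm (y - x)"
  proof -
    have *: "\<forall>e>0. \<exists>d>0. \<forall>y\<in>UNIV. norm (y - x) < d \<longrightarrow> norm (G' y u - G' x u - D (y - x)) \<le> e * norm (y - x)"
      using D[unfolded has_derivative_within_alt] by (rule conjunct2)
    have "e / (2 * c) > 0" using e c by simp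
    then have "\<exists>d>0. \<forall>y\<in>UNIV. norm (y - x) < d \<longrightarrow> norm (G' y u - G' x u - D (y - x)) \<le> e / (2 * c) * norm (y - x)"
      by (rule *[THEN spec, THEN mp])
    then show ?thesis using that by (auto simp only: real_norm_def UNIV_I)
  qed
  define \<delta> where "\<delta> = min \<eta> r / c"
  have "\<delta> > 0" using \<eta> r c by (simp add: \<delta>_def)
  moreover have "\<bar>G (x + t *\<^sub>R u + t *\<^sub>R v) - G (x + t *\<^sub>R u) - G (x + t *\<^sub>R v) + G x - t\<^sup>2 * D v\<bar> \<le> e * t\<^sup>2"
    if t: "0 < t" "t < \<delta>" for t
  proof -
    have tc: "t * c < \<eta>" "t * c < r"
      using t c by (simp_all add: \<delta>_def pos_less_divide_eq)
    have near: "norm (s *\<^sub>R u + q *\<^sub>R v) \<le> t * c" if "0 \<le> s" "s \<le> t" "0 \<le> q" "q \<le> t" for s q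
    proof -
      have "norm (s *\<^sub>R u + q *\<^sub>R v) \<le> s * norm u + q * norm v"
        using norm_triangle_ineq[of "s *\<^sub>R u" "q *\<^sub>R v"] that by simp
      also have "\<dots> \<le> t * norm u + t * norm v"
        using that by (intro add_mono mult_right_mono) auto
      also have "\<dots> \<le> t * c" using t by (simp add: c_def algebra_simps)
      finally show ?thesis .
    qed
    have inU: "x + s *\<^sub>R u + q *\<^sub>R v \<in> U" if "0 \<le> s" "s \<le> t" "0 \<le> q" "q \<le> t" for s q
    proof -
      have "dist x (x + s *\<^sub>R u + q *\<^sub>R v) = norm (s *\<^sub>R u + q *\<^sub>R v)"
        by (simp add: dist_norm norm_minus_commute add.assoc add.commute)
      then show ?thesis using near[OF that] tc r by (auto simp: subset_iff)
    qed
    have der: "((\<lambda>s. G (x + s *\<^sub>R u + q *\<^sub>R v)) has_real_derivative G' (x + s *\<^sub>R u + q *\<^sub>R v) u) (at s)"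
      if "0 \<le> s" "s \<le> t" "0 \<le> q" "q \<le> t" for s q
    proof -
      have "((\<lambda>s. x + s *\<^sub>R u + q *\<^sub>R v) has_derivative (\<lambda>h. h *\<^sub>R u)) (at s)"
        by (auto intro!: derivative_eq_intros)
      from has_derivative_compose[OF this G[OF inU[OF that]]]
      have "((\<lambda>s. G (x + s *\<^sub>R u + q *\<^sub>R v)) has_derivative (\<lambda>h. G' (x + s *\<^sub>R u + q *\<^sub>R v) (h *\<^sub>R u))) (at s)" .
      moreover have "G' (x + s *\<^sub>R u + q *\<^sub>R v) (h *\<^sub>R u) = G' (x + s *\<^sub>R u + q *\<^sub>R v) u * h" for h
        using has_derivative_linear[OF G[OF inU[OF that]]] by (simp add: linear_scale)
      ultimately show ?thesis by (simp add: has_field_derivative_def)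
    qed
    (* The second difference is the increment of psi over [0, t]. *)
    define \<psi> where "\<psi> s = G (x + s *\<^sub>R u + t *\<^sub>R v) - G (x + s *\<^sub>R u)" for s
    have d\<psi>: "(\<psi> has_real_derivative G' (x + s *\<^sub>R u + t *\<^sub>R v) u - G' (x + s *\<^sub>R u) u) (at s)"
      if "0 \<le> s" "s \<le> t" for s
      unfolding \<psi>_def using der[of s t] der[of s 0] that t by (intro DERIV_diff) auto
    obtain s where s: "0 < s" "s < t" and
      mvt: "\<psi> t - \<psi> 0 = (t - 0) * (G' (x + s *\<^sub>R u + t *\<^sub>R v) u - G' (x + s *\<^sub>R u) u)"
      using MVT2[OF t(1), of \<psi>, OF d\<psi>] by blast
    have a1: "\<bar>G' (x + s *\<^sub>R u + q *\<^sub>R v) u - G' x u - D (s *\<^sub>R u + q *\<^sub>R v)\<bar> \<le> e / 2 * t"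
      if "0 \<le> q" "q \<le> t" for q
    proof -
      have n: "norm (s *\<^sub>R u + q *\<^sub>R v) \<le> t * c" using near[of s q] that s by auto
      have "\<bar>G' (x + s *\<^sub>R u + q *\<^sub>R v) u - G' x u - D (s *\<^sub>R u + q *\<^sub>R v)\<bar>
          \<le> e / (2 * c) * norm (s *\<^sub>R u + q *\<^sub>R v)"
        using approx[of "x + s *\<^sub>R u + q *\<^sub>R v"] n tc by (simp add: add.assoc)
      also have "\<dots> \<le> e / (2 * c) * (t * c)"
        using n e c by (intro mult_left_mono) auto
      finally show ?thesis using c by simp
    qed
    have "\<bar>G' (x + s *\<^sub>R u + t *\<^sub>R v) u - G' (x + s *\<^sub>R u) u - t * D v\<bar> \<le> e * t"
    proof -
      have "D (s *\<^sub>R u + t *\<^sub>R v) = D (s *\<^sub>R u) + t * D v"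
        by (simp add: linear_add[OF lin] linear_scale[OF lin])
      then show ?thesis
        using abs_triangle_ineq4[of "G' (x + s *\<^sub>R u + t *\<^sub>R v) u - G' x u - D (s *\<^sub>R u + t *\<^sub>R v)"
            "G' (x + s *\<^sub>R u + 0 *\<^sub>R v) u - G' x u - D (s *\<^sub>R u + 0 *\<^sub>R v)"]
          add_mono[OF a1[of t] a1[of 0]] t
        by (simp add: algebra_simps)
    qed
    then have "\<bar>t * (G' (x + s *\<^sub>R u + t *\<^sub>R v) u - G' (x + s *\<^sub>R u) u - t * D v)\<bar> \<le> t * (e * t)"
      using t unfolding abs_mult by (intro mult_mono) auto
    then have "\<bar>t * (G' (x + s *\<^sub>R u + t *\<^sub>R v) u - G' (x + s *\<^sub>R u) u) - t\<^sup>2 * D v\<bar> \<le> e * t\<^sup>2"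
      by (simp only: right_diff_distrib power2_eq_square mult_ac)
    moreover have "G (x + t *\<^sub>R u + t *\<^sub>R v) - G (x + t *\<^sub>R u) - G (x + t *\<^sub>R v) + G x = \<psi> t - \<psi> 0"
      by (simp add: \<psi>_def)
    ultimately show ?thesis using mvt by simp
  qed
  ultimately show ?thesis by blast
qed

lemma second_derivative_symmetric_real:
  fixes G :: "'v::real_normed_vector \<Rightarrow> real"
  assumes U: "open U" "x \<in> U" and G: "\<And>y. y \<in> U \<Longrightarrow> (G has_derivative G' y) (at y)"
    and D: "\<And>u. ((\<lambda>y. G' y u) has_derivative (\<lambda>w. D w u)) (at x)"
  shows "D u v = D v u"
proof -
  have "\<bar>D v u - D u v\<bar> \<le> 2 * e" if e: "e > 0" for e
  proof -
    obtain \<delta>1 where 1: "\<delta>1 > 0" "\<And>t. 0 < t \<Longrightarrow> t < \<delta>1 \<Longrightarrow>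
        \<bar>G (x + t *\<^sub>R u + t *\<^sub>R v) - G (x + t *\<^sub>R u) - G (x + t *\<^sub>R v) + G x - t\<^sup>2 * D v u\<bar> \<le> e * t\<^sup>2"
      using second_difference_quotient[OF U G D e] by metis
    obtain \<delta>2 where 2: "\<delta>2 > 0" "\<And>t. 0 < t \<Longrightarrow> t < \<delta>2 \<Longrightarrow>
        \<bar>G (x + t *\<^sub>R v + t *\<^sub>R u) - G (x + t *\<^sub>R v) - G (x + t *\<^sub>R u) + G x - t\<^sup>2 * D u v\<bar> \<le> e * t\<^sup>2"
      using second_difference_quotient[OF U G D e] by metis
    define t where "t = min \<delta>1 \<delta>2 / 2"
    have t: "0 < t" "t < \<delta>1" "t < \<delta>2" using 1 2 by (auto simp: t_def)
    have "x + t *\<^sub>R v + t *\<^sub>R u = x + t *\<^sub>R u + t *\<^sub>R v" by simp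
    then have "\<bar>t\<^sup>2 * D v u - t\<^sup>2 * D u v\<bar> \<le> 2 * (e * t\<^sup>2)"
      using 1(2)[OF t(1,2)] 2(2)[OF t(1,3)] by (simp only:)
    moreover have "t\<^sup>2 * \<bar>D v u - D u v\<bar> = \<bar>t\<^sup>2 * D v u - t\<^sup>2 * D u v\<bar>"
      by (simp only: right_diff_distrib[symmetric] abs_mult abs_power2)
    ultimately have "t\<^sup>2 * \<bar>D v u - D u v\<bar> \<le> t\<^sup>2 * (2 * e)"
      by (simp add: mult_ac)
    then show ?thesis using t by (simp add: mult_le_cancel_left_pos)
  qed
  from this[of "\<bar>D v u - D u v\<bar> / 4"] show ?thesis
    by (cases "D v u = D u v") auto
qed

text \<open>
  Near \<open>x\<close> the one-sided derivative of \<open>F\<close> on the half-space coincides with the derivative of a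
  smooth extension, whose second derivatives commute in the ordinary sense.
\<close>

lemma smooth_on_second_derivative:
  fixes F :: "'d::{finite,linorder} rvec \<Rightarrow> 'e::finite rvec"
  assumes S: "openin (top_of_set half_space) S" and F: "smooth_on S F" and x: "x \<in> S"
  shows "\<exists>D. (\<forall>u. ((\<lambda>y. hderiv F y u) has_derivative (\<lambda>w. D w u)) (at x within half_space)) \<and>
    (\<forall>u w. D w u = D u w)"
proof -
  obtain U G where U: "open U" "x \<in> U" "\<forall>k. Ck_on k G U" and eq: "\<forall>y\<in>S \<inter> U. G y = F y"
    using F x by (auto simp only: smooth_on_def)
  have "Ck_on (Suc (Suc 0)) G U" using U(3) by blast
  then obtain G' where G': "\<And>y. y \<in> U \<Longrightarrow> (G has_derivative G' y) (at y)"
    and "\<And>v. Ck_on (Suc 0) (\<lambda>y. G' y v) U"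
    by (auto simp del: Ck_on.simps(1))
  then have "\<forall>v. \<exists>D. ((\<lambda>y. G' y v) has_derivative D) (at x)"
    using U(2) by (auto simp del: Ck_on.simps(1)) blast
  then obtain D0 where D0: "\<And>v. ((\<lambda>y. G' y v) has_derivative D0 v) (at x)"
    by metis
  define D where "D w v = D0 v w" for w v
  have D: "((\<lambda>y. G' y v) has_derivative (\<lambda>w. D w v)) (at x)" for v
    using D0[of v] by (simp add: D_def)
  have "D w u = D u w" for u w
  proof -
    have "D w u $ i = D u w $ i" for i
      by (rule second_derivative_symmetric_real[OF U(1,2), of "\<lambda>y. G y $ i" "\<lambda>y v. G' y v $ i" "\<lambda>w v. D w v $ i"])
        (auto intro!: bounded_linear.has_derivative[OF bounded_linear_vec_nth] G' D)
    then show ?thesis by (simp add: vec_eq_iff)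
  qed
  moreover have "((\<lambda>y. hderiv F y u) has_derivative (\<lambda>w. D w u)) (at x within half_space)" for u
  proof -
    have SU: "openin (top_of_set half_space) (S \<inter> U)"
      using S U(1) by (simp add: openin_Int_open)
    have H: "S \<subseteq> half_space" using S openin_imp_subset by blast
    have G'_eq: "hderiv F y = G' y" if y: "y \<in> S \<inter> U" for y
    proof (rule hderiv_eq)
      show "y \<in> half_space" using y H by auto
      have "(G has_derivative G' y) (at y within S \<inter> U)"
        using G' y by (auto intro: has_derivative_at_withinI)
      then have "(F has_derivative G' y) (at y within S \<inter> U)"
        by (rule has_derivative_transform[rotated 2]) (use eq y in auto)
      then show "(F has_derivative G' y) (at y within half_space)"
        using at_within_openin[OF SU y] by simp
    qed
    have "((\<lambda>y. G' y u) has_derivative (\<lambda>w. D w u)) (at x within S \<inter> U)"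
      using D by (rule has_derivative_at_withinI)
    then have "((\<lambda>y. hderiv F y u) has_derivative (\<lambda>w. D w u)) (at x within S \<inter> U)"
      by (rule has_derivative_transform[rotated 2]) (use G'_eq x U in auto)
    then show ?thesis
      using at_within_openin[OF SU, of x] x U by simp
  qed
  ultimately show ?thesis by blast
qed

section \<open>Derivatives of determinants and of volume densities\<close>

text \<open>
  The Leibniz rule, obtained by expanding both arguments in the standard basis.
\<close>

lemma has_derivative_bilinear_family:
  fixes Q :: "'v::real_normed_vector \<Rightarrow> 'd::finite rvec \<Rightarrow> 'd rvec \<Rightarrow> real"
  assumes x: "x \<in> S" and Q: "\<And>y. y \<in> S \<Longrightarrow> bilinear (Q y)" "\<And>w. bilinear (DQ w)"
    and DQ: "\<And>u v. ((\<lambda>y. Q y u v) has_derivative (\<lambda>w. DQ w u v)) (at x within S)"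
    and a: "(a has_derivative a') (at x within S)" and b: "(b has_derivative b') (at x within S)"
  shows "((\<lambda>y. Q y (a y) (b y)) has_derivative
    (\<lambda>w. DQ w (a x) (b x) + Q x (a' w) (b x) + Q x (a x) (b' w))) (at x within S)"
proof -
  have comp: "((\<lambda>y. a y $ i) has_derivative (\<lambda>w. a' w $ i)) (at x within S)"
    "((\<lambda>y. b y $ i) has_derivative (\<lambda>w. b' w $ i)) (at x within S)" for i
    using a b by (auto intro: bounded_linear.has_derivative[OF bounded_linear_vec_nth])
  have "((\<lambda>y. \<Sum>i\<in>UNIV. \<Sum>j\<in>UNIV. (a y $ i * b y $ j) *\<^sub>R Q y (axis i 1) (axis j 1)) has_derivative
      (\<lambda>w. \<Sum>i\<in>UNIV. \<Sum>j\<in>UNIV. (a x $ i * b x $ j) *\<^sub>R DQ w (axis i 1) (axis j 1)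
        + (a' w $ i * b x $ j) *\<^sub>R Q x (axis i 1) (axis j 1)
        + (a x $ i * b' w $ j) *\<^sub>R Q x (axis i 1) (axis j 1))) (at x within S)"
    by (rule has_derivative_sum)+ (auto intro!: derivative_eq_intros comp DQ simp: algebra_simps)
  moreover have "(\<Sum>i\<in>UNIV. \<Sum>j\<in>UNIV. (a x $ i * b x $ j) *\<^sub>R DQ w (axis i 1) (axis j 1)
        + (a' w $ i * b x $ j) *\<^sub>R Q x (axis i 1) (axis j 1)
        + (a x $ i * b' w $ j) *\<^sub>R Q x (axis i 1) (axis j 1))
      = DQ w (a x) (b x) + Q x (a' w) (b x) + Q x (a x) (b' w)" for w
    by (simp only: bilinear_eq_sum_axis[OF Q(1)[OF x], of "a' w"] bilinear_eq_sum_axis[OF Q(1)[OF x], of _ "b' w"]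
        bilinear_eq_sum_axis[OF Q(2), of _ "a x" "b x"] sum.distrib)
  ultimately have "((\<lambda>y. \<Sum>i\<in>UNIV. \<Sum>j\<in>UNIV. (a y $ i * b y $ j) *\<^sub>R Q y (axis i 1) (axis j 1)) has_derivative
      (\<lambda>w. DQ w (a x) (b x) + Q x (a' w) (b x) + Q x (a x) (b' w))) (at x within S)"
    by (simp only:)
  then show ?thesis
    by (rule has_derivative_transform[OF x, rotated]) (rule bilinear_eq_sum_axis[OF Q(1)])
qed

lemma has_derivative_vec_lambda:
  fixes f :: "'i::finite \<Rightarrow> 'v::real_normed_vector \<Rightarrow> real"
  assumes "\<And>i. (f i has_derivative f' i) (at x within S)"
  shows "((\<lambda>y. \<chi> i. f i y) has_derivative (\<lambda>w. \<chi> i. f' i w)) (at x within S)"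
  by (subst has_derivative_componentwise_within)
    (auto simp: Basis_vec_def inner_axis assms)

text \<open>
  The determinant is multilinear in the rows, so its derivative replaces one row at a time.
\<close>

lemma has_derivative_det:
  fixes M :: "'v::real_normed_vector \<Rightarrow> real^'n^'n"
  assumes M: "\<And>i j. ((\<lambda>y. M y $ i $ j) has_derivative (\<lambda>w. M' w $ i $ j)) (at x within S)"
  shows "((\<lambda>y. det (M y)) has_derivative
    (\<lambda>w. \<Sum>i\<in>UNIV. det (\<chi> k. if k = i then M' w $ i else M x $ k))) (at x within S)"
proof -
  have "((\<lambda>y. det (M y)) has_derivative
      (\<lambda>w. \<Sum>p | p permutes (UNIV :: 'n set). of_int (sign p) *
        (\<Sum>i\<in>UNIV. M' w $ i $ p i * (\<Prod>k\<in>UNIV - {i}. M x $ k $ p k)))) (at x within S)"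
    unfolding det_def
    by (intro has_derivative_sum has_derivative_mult_right has_derivative_prod M)
  moreover have "(\<Sum>p | p permutes (UNIV :: 'n set). of_int (sign p) *
        (\<Sum>i\<in>UNIV. M' w $ i $ p i * (\<Prod>k\<in>UNIV - {i}. M x $ k $ p k)))
      = (\<Sum>i\<in>UNIV. det (\<chi> k. if k = i then M' w $ i else M x $ k))" for w
  proof -
    have "(\<Prod>k\<in>UNIV. (\<chi> k. if k = i then M' w $ i else M x $ k) $ k $ p k)
        = M' w $ i $ p i * (\<Prod>k\<in>UNIV - {i}. M x $ k $ p k)" for i p
      by (subst prod.remove[of UNIV i]) (auto intro!: prod.cong)
    then show ?thesis
      unfolding det_def by (simp only: sum_distrib_left) (rule sum.swap)
  qed
  ultimately show ?thesis by (simp only:)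
qed

text \<open>
  The \<open>i\<close>-th row of \<open>K M\<close> is a combination of the rows of \<open>M\<close>. Put in place of the \<open>i\<close>-th row
  of \<open>M\<close>, every term except the multiple \<open>K\<^sub>i\<^sub>i\<close> of that row itself repeats another row.
\<close>

lemma sum_det_row_replaced:
  fixes M K :: "real^'n^'n"
  shows "(\<Sum>i\<in>UNIV. det (\<chi> k. if k = i then (K ** M) $ i else M $ k)) = trace K * det M"
proof -
  have "det (\<chi> k. if k = i then (K ** M) $ i else M $ k) = K $ i $ i * det M" for i
  proof -
    have "(K ** M) $ i = (\<Sum>j\<in>UNIV. K $ i $ j *s M $ j)"
      by (simp add: vec_eq_iff matrix_matrix_mult_def sum_component)
    then have "det (\<chi> k. if k = i then (K ** M) $ i else M $ k)
        = (\<Sum>j\<in>UNIV. det (\<chi> k. if k = i then K $ i $ j *s M $ j else M $ k))"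
      by (simp only: det_linear_row_sum[OF finite])
    also have "\<dots> = (\<Sum>j\<in>UNIV. K $ i $ j * det (\<chi> k. if k = i then M $ j else M $ k))"
      by (simp only: det_row_mul)
    also have "\<dots> = (\<Sum>j\<in>UNIV. if j = i then K $ i $ i * det M else 0)"
    proof (rule sum.cong[OF refl])
      fix j
      show "K $ i $ j * det (\<chi> k. if k = i then M $ j else M $ k) = (if j = i then K $ i $ i * det M else 0)"
      proof (cases "j = i")
        case True
        then have "(\<chi> k. if k = i then M $ j else M $ k) = M" by (simp add: vec_eq_iff)
        with True show ?thesis by simp
      next
        case False
        then have "det (\<chi> k. if k = i then M $ j else M $ k) = 0"
          by (intro det_identical_rows[of i j]) (auto simp: row_def)
        with False show ?thesis by simp
      qed
    qed
    finally show ?thesis by simp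
  qed
  then show ?thesis by (simp add: trace_def sum_distrib_right)
qed

text \<open>
  Jacobi's formula, for a derivative written as \<open>M' = K M\<close>. In this form the cofactors of \<open>M\<close> do
  not appear.
\<close>

lemma has_derivative_det_mult:
  fixes M :: "'v::real_normed_vector \<Rightarrow> real^'n^'n"
  assumes "\<And>i j. ((\<lambda>y. M y $ i $ j) has_derivative (\<lambda>w. (K w ** M x) $ i $ j)) (at x within S)"
  shows "((\<lambda>y. det (M y)) has_derivative (\<lambda>w. trace (K w) * det (M x))) (at x within S)"
  using has_derivative_det[of M "\<lambda>w. K w ** M x", OF assms] by (simp only: sum_det_row_replaced)

lemma matrix_add_rdistrib: "(A + B) ** C = A ** C + B ** (C :: real^'n^'m)"
  by (simp add: vec_eq_iff matrix_matrix_mult_def sum.distrib distrib_right)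

text \<open>
  The logarithmic derivative of a Riemannian volume density is the trace of the connection
  coefficients. If \<open>G' = L\<^sup>T G + G L\<close>, then \<open>G' = (L\<^sup>T + G L G\<^sup>-\<^sup>1) G\<close>, and the factor in
  front of \<open>G\<close> has trace \<open>2 tr L\<close>; the square root halves it.
\<close>

lemma has_derivative_sqrt_det_gram_matrix:
  fixes g :: "'v::real_normed_vector \<Rightarrow> 'd::finite rvec \<Rightarrow> 'd rvec \<Rightarrow> real"
  assumes g: "inner_product (g x)" and L: "\<And>w. linear (L w)"
    and D: "\<And>u v. ((\<lambda>y. g y u v) has_derivative (\<lambda>w. g x (L w u) v + g x u (L w v))) (at x within S)"
  shows "((\<lambda>y. sqrt (det (gram_matrix (g y)))) has_derivative
    (\<lambda>w. trace (matrix (L w)) * sqrt (det (gram_matrix (g x))))) (at x within S)"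
proof -
  let ?G = "gram_matrix (g x)"
  have bil: "bilinear (g x)" using g by (simp add: inner_product_def)
  have lin: "linear (\<lambda>u. g x u v)" "linear (g x u)" for u v using bil by (auto simp: bilinear_def)
  have pos: "det ?G > 0" by (rule det_gram_matrix_pos[OF g])
  then have "invertible ?G" by (simp add: invertible_det_nz)
  then obtain Gi where Gi: "?G ** Gi = mat 1" "Gi ** ?G = mat 1" by (auto simp: invertible_def)
  define K where "K w = transpose (matrix (L w)) + ?G ** matrix (L w) ** Gi" for w
  have KG: "K w ** ?G = transpose (matrix (L w)) ** ?G + ?G ** matrix (L w)" for w
    by (simp add: K_def matrix_add_rdistrib Gi flip: matrix_mul_assoc)
  have "(K w ** ?G) $ i $ j = g x (L w (axis i 1)) (axis j 1) + g x (axis i 1) (L w (axis j 1))" for w i j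
    unfolding KG linear_eq_sum_axis[OF lin(1), of "L w (axis i 1)"] linear_eq_sum_axis[OF lin(2), of _ "L w (axis j 1)"]
    by (simp add: matrix_matrix_mult_def transpose_def matrix_def gram_matrix_def mult.commute)
  then have "((\<lambda>y. gram_matrix (g y) $ i $ j) has_derivative (\<lambda>w. (K w ** ?G) $ i $ j)) (at x within S)" for i j
    using D[of "axis i 1" "axis j 1"] by (simp only: gram_matrix_def vec_lambda_beta)
  then have "((\<lambda>y. det (gram_matrix (g y))) has_derivative (\<lambda>w. trace (K w) * det ?G)) (at x within S)"
    by (rule has_derivative_det_mult)
  from has_derivative_real_sqrt[OF pos this]
  have *: "((\<lambda>y. sqrt (det (gram_matrix (g y)))) has_derivative
      (\<lambda>w. trace (K w) * det ?G * (inverse (sqrt (det ?G)) / 2))) (at x within S)" .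
  have "trace (K w) = 2 * trace (matrix (L w))" for w
  proof -
    have "trace (?G ** matrix (L w) ** Gi) = trace (matrix (L w))"
      by (subst trace_mul_sym) (simp add: matrix_mul_assoc Gi)
    then show ?thesis by (simp add: K_def trace_add trace_def[of "transpose _"] transpose_def) (simp add: trace_def)
  qed
  moreover have "det ?G * inverse (sqrt (det ?G)) = sqrt (det ?G)"
    using pos by (simp add: real_div_sqrt flip: divide_inverse)
  ultimately have "trace (K w) * det ?G * (inverse (sqrt (det ?G)) / 2)
      = trace (matrix (L w)) * sqrt (det ?G)" for w
    by simp
  then show ?thesis using * by (simp only:)
qed

lemma trace_orthonormal_basis:
  fixes T :: "'d::finite rvec \<Rightarrow> 'd rvec"
  assumes g: "inner_product g" and E: "orthonormal_basis g E" and T: "linear T"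
  shows "trace (matrix T) = (\<Sum>i\<in>UNIV. g (T (E i)) (E i))"
proof -
  have bil: "bilinear g" using g by (simp add: inner_product_def)
  then have lin: "linear (\<lambda>u. g u v)" for v by (simp add: bilinear_def)
  have "T (axis k 1) = (\<Sum>i\<in>UNIV. g (axis k 1) (E i) *\<^sub>R T (E i))" for k
    using arg_cong[OF orthonormal_coords[OF g E, of "axis k 1"], of T]
    by (simp add: linear_sum[OF T] linear_scale[OF T])
  then have "trace (matrix T) = (\<Sum>k\<in>UNIV. \<Sum>i\<in>UNIV. g (axis k 1) (E i) * T (E i) $ k)"
    by (simp add: trace_def matrix_def)
  also have "\<dots> = (\<Sum>i\<in>UNIV. \<Sum>k\<in>UNIV. T (E i) $ k * g (axis k 1) (E i))"
    by (subst sum.swap) (simp add: mult.commute)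
  also have "\<dots> = (\<Sum>i\<in>UNIV. g (T (E i)) (E i))"
    by (simp add: linear_eq_sum_axis[OF lin, of "T (E _)"])
  finally show ?thesis .
qed

section \<open>The divergence of a map with a prescribed adjoint\<close>

lemma family_has_derivative:
  assumes "\<And>k. f k differentiable F"
  shows "\<exists>D. \<forall>k. (f k has_derivative D k) F"
  using assms by (intro choice allI) (simp add: differentiable_def)

lemma differentiable_det:
  fixes M :: "'v::real_normed_vector \<Rightarrow> real^'n^'n"
  assumes "\<And>i j. (\<lambda>y. M y $ i $ j) differentiable (at x within S)"
  shows "(\<lambda>y. det (M y)) differentiable (at x within S)"
proof -
  obtain D where "\<And>i j. ((\<lambda>y. M y $ i $ j) has_derivative D i j) (at x within S)"
    using assms[unfolded differentiable_def] by metis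
  then have "((\<lambda>y. M y $ i $ j) has_derivative (\<lambda>w. (\<chi> i j. D i j w) $ i $ j)) (at x within S)" for i j
    by simp
  from has_derivative_det[where M' = "\<lambda>w. \<chi> i j. D i j w", OF this] show ?thesis
    by (rule differentiableI)
qed

text \<open>
  By Cramer's rule the solution is a quotient of determinants. Thus a map that is only known
  through a linear system, like the cofactor below, is differentiable.
\<close>

lemma differentiable_linear_system:
  fixes N :: "'v::real_normed_vector \<Rightarrow> real^'n^'n"
  assumes x: "x \<in> S" and det: "\<And>y. y \<in> S \<Longrightarrow> det (N y) \<noteq> 0"
    and z: "\<And>y. y \<in> S \<Longrightarrow> N y *v z y = b y"
    and N: "\<And>i j. (\<lambda>y. N y $ i $ j) differentiable (at x within S)"
    and b: "\<And>i. (\<lambda>y. b y $ i) differentiable (at x within S)"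
  shows "z differentiable (at x within S)"
proof -
  let ?q = "\<lambda>k y. det (\<chi> i j. if j = k then b y $ i else N y $ i $ j) / det (N y)"
  have "(\<lambda>y. (\<chi> i j. if j = k then b y $ i else N y $ i $ j) $ i $ j) differentiable (at x within S)" for i j k
    using N b by (cases "j = k") auto
  then have "?q k differentiable (at x within S)" for k
    using det[OF x] by (intro differentiable_divide differentiable_det N) auto
  then obtain D where "\<forall>k. (?q k has_derivative D k) (at x within S)"
    using family_has_derivative[of ?q] by blast
  then have "(?q k has_derivative D k) (at x within S)" for k
    by (rule spec)
  then have "((\<lambda>y. \<chi> k. ?q k y) has_derivative (\<lambda>w. \<chi> k. D k w)) (at x within S)"
    by (rule has_derivative_vec_lambda)
  then have "(z has_derivative (\<lambda>w. \<chi> k. D k w)) (at x within S)"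
    by (rule has_derivative_transform[OF x, rotated]) (rule cramer[OF det, THEN iffD1, OF _ z])
  then show ?thesis by (rule differentiableI)
qed

text \<open>
  This is the coordinate form of the computation described at the beginning: \<open>A\<close> plays the role of
  the differential and \<open>Z\<close> that of its cofactor, \<open>D2\<close> is the second derivative of \<open>f\<close>, and \<open>h\<close> is the
  metric of the target along \<open>f\<close>, so the chain rule puts \<open>A x w\<close> into its derivative. The constant
  \<open>\<sigma>\<close> carries the orientations.
\<close>

lemma divergence_eq_0_of_adjoint_identity:
  fixes g h :: "'d::{finite,linorder} rvec \<Rightarrow> 'd rvec \<Rightarrow> 'd rvec \<Rightarrow> real"
    and A Z :: "'d rvec \<Rightarrow> 'd rvec \<Rightarrow> 'd rvec"
  assumes S: "openin (top_of_set half_space) S" and x: "x \<in> S"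
    and g: "\<And>y. y \<in> S \<Longrightarrow> inner_product (g y)"
    and h: "\<And>y. y \<in> S \<Longrightarrow> inner_product (h y)"
    and A: "\<And>y. y \<in> S \<Longrightarrow> linear (A y)" "\<And>y. y \<in> S \<Longrightarrow> det (matrix (A y)) \<noteq> 0"
    and DA: "\<And>u. ((\<lambda>y. A y u) has_derivative (\<lambda>w. D2 w u)) (at x within half_space)"
    and D2: "\<And>u w. D2 u w = D2 w u"
    and Dg: "\<And>u v. ((\<lambda>y. g y u v) has_derivative (\<lambda>w. Dg w u v)) (at x within half_space)"
    and \<Gamma>: "levi_civita_coeff (g x) Dg \<Gamma>"
    and Dh: "\<And>u v. ((\<lambda>y. h y u v) has_derivative (\<lambda>w. Dh (A x w) u v)) (at x within half_space)"
    and \<Gamma>': "levi_civita_coeff (h x) Dh \<Gamma>'"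
    and Z: "\<And>y u v. y \<in> S \<Longrightarrow> h y (A y u) (Z y v) = \<sigma> * det (matrix (A y)) *
        (sqrt (det (gram_matrix (h y))) / sqrt (det (gram_matrix (g y)))) * g y u v"
    and E: "orthonormal_basis (g x) E"
  shows "(\<Sum>i\<in>UNIV. hderiv (\<lambda>y. Z y (E i)) x (E i) + \<Gamma>' (A x (E i)) (Z x (E i))
      - Z x (\<Gamma> (E i) (E i))) = 0"
proof -
  have at_eq: "at x within half_space = at x within S"
    by (rule at_within_openin[OF S x])
  have xH: "x \<in> half_space" using S x openin_imp_subset by blast
  have lin_g: "linear (\<lambda>u. g y u v)" "linear (g y u)"
    and lin_h: "linear (\<lambda>u. h y u v)" "linear (h y u)"
    and bil_g: "bilinear (g y)" and bil_h: "bilinear (h y)" if "y \<in> S" for y u v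
    using g[OF that] h[OF that] by (auto simp: inner_product_def bilinear_def)
  have lin_\<Gamma>: "linear (\<Gamma> u)" and lin_\<Gamma>': "linear (\<Gamma>' u)" "linear (\<lambda>u. \<Gamma>' u v)" for u v
    using \<Gamma> \<Gamma>' by (auto simp: levi_civita_coeff_def bilinear_def)
  have sym_\<Gamma>: "\<Gamma> u v = \<Gamma> v u" and sym_\<Gamma>': "\<Gamma>' u v = \<Gamma>' v u" for u v
    using \<Gamma> \<Gamma>' by (auto simp: levi_civita_coeff_def)
  have Dg_eq: "Dg u v w = g x (\<Gamma> u v) w + g x v (\<Gamma> u w)"
    and Dh_eq: "Dh u v w = h x (\<Gamma>' u v) w + h x v (\<Gamma>' u w)" for u v w
    using \<Gamma> \<Gamma>' by (auto simp: levi_civita_coeff_def)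
  have bil_Dh: "bilinear (Dh w)" for w
    unfolding bilinear_def Dh_eq
    by (intro conjI allI linearI; simp add: linear_add[OF lin_\<Gamma>'(1)] linear_scale[OF lin_\<Gamma>'(1)]
        bilinear_ladd[OF bil_h[OF x]] bilinear_radd[OF bil_h[OF x]]
        bilinear_lmul[OF bil_h[OF x]] bilinear_rmul[OF bil_h[OF x]] algebra_simps)
  note linA = A(1)[OF x]
  have lin_D2: "linear (D2 w)" for w
  proof -
    have "D2 w = (\<lambda>u. D2 u w)" using D2 by blast
    then show ?thesis using has_derivative_linear[OF DA[of w]] by simp
  qed

  define MA where "MA = matrix (A x)"
  have "invertible MA" using A(2)[OF x] by (simp add: MA_def invertible_det_nz)
  then obtain Ai where Ai: "MA ** Ai = mat 1" "Ai ** MA = mat 1" by (auto simp: invertible_def)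
  have MA: "MA *v v = A x v" for v
    using fun_cong[OF matrix_vector_mul(2)[OF linA], of v] by (simp add: MA_def)
  have A_Ai: "A x (Ai *v v) = v" and Ai_A: "Ai *v A x v = v" for v
    unfolding MA[symmetric] by (simp_all add: matrix_vector_mul_assoc Ai)
  have lin_Ai: "linear ((*v) Ai)" by (rule matrix_vector_mul_linear)

  define J where "J y = \<sigma> * det (matrix (A y)) *
    (sqrt (det (gram_matrix (h y))) / sqrt (det (gram_matrix (g y))))" for y
  have Z': "h y (A y u) (Z y v) = J y * g y u v" if "y \<in> S" for y u v
    using Z[OF that] by (simp add: J_def)
  (* The logarithmic derivative of J, one trace for each of its three factors. *)
  define \<tau> where "\<tau> w = trace (matrix (D2 w) ** Ai) + trace (matrix (\<Gamma>' (A x w))) - trace (matrix (\<Gamma> w))" for w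

  have dJ: "(J has_derivative (\<lambda>w. J x * \<tau> w)) (at x within half_space)"
  proof -
    have "((\<lambda>y. matrix (A y) $ i $ j) has_derivative
        (\<lambda>w. ((matrix (D2 w) ** Ai) ** matrix (A x)) $ i $ j)) (at x within half_space)" for i j
    proof -
      have "((\<lambda>y. A y (axis j 1) $ i) has_derivative (\<lambda>w. D2 w (axis j 1) $ i)) (at x within half_space)"
        by (rule bounded_linear.has_derivative[OF bounded_linear_vec_nth DA])
      then show ?thesis
        using Ai by (simp add: MA_def flip: matrix_mul_assoc) (simp add: matrix_def)
    qed
    then have 1: "((\<lambda>y. det (matrix (A y))) has_derivative
        (\<lambda>w. trace (matrix (D2 w) ** Ai) * det (matrix (A x)))) (at x within half_space)"
      by (rule has_derivative_det_mult)
    have 2: "((\<lambda>y. sqrt (det (gram_matrix (h y)))) has_derivative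
        (\<lambda>w. trace (matrix (\<Gamma>' (A x w))) * sqrt (det (gram_matrix (h x))))) (at x within half_space)"
      using Dh by (intro has_derivative_sqrt_det_gram_matrix h x lin_\<Gamma>') (simp add: Dh_eq)
    have 3: "((\<lambda>y. sqrt (det (gram_matrix (g y)))) has_derivative
        (\<lambda>w. trace (matrix (\<Gamma> w)) * sqrt (det (gram_matrix (g x))))) (at x within half_space)"
      using Dg by (intro has_derivative_sqrt_det_gram_matrix g x lin_\<Gamma>) (simp add: Dg_eq)
    have pos: "sqrt (det (gram_matrix (g x))) \<noteq> 0"
      using det_gram_matrix_pos[OF g[OF x]] by simp
    show ?thesis
      unfolding J_def \<tau>_def
      by (rule has_derivative_eq_rhs, (rule derivative_intros 1 2 3 pos)+)
        (use pos in \<open>auto simp: fun_eq_iff field_simps\<close>)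
  qed

  (* The identity for Z, tested on the basis vectors u, is a linear system for Z y v with matrix N y. *)
  define N where "N y = transpose (matrix (A y)) ** gram_matrix (h y)" for y
  have N_nth: "N y $ i $ j = h y (A y (axis i 1)) (axis j 1)" if "y \<in> S" for y i j
    unfolding linear_eq_sum_axis[OF lin_h(1)[OF that], of "A y (axis i 1)"]
    by (simp add: N_def matrix_matrix_mult_def transpose_def matrix_def gram_matrix_def)
  have dAu: "((\<lambda>y. h y (A y u) v) has_derivative
      (\<lambda>w. Dh (A x w) (A x u) v + h x (D2 w u) v + h x (A x u) 0)) (at x within S)" for u v
    using x bil_h bil_Dh Dh[unfolded at_eq] DA[unfolded at_eq, of u]
    by (rule has_derivative_bilinear_family) (auto intro: derivative_intros)
  have dJg: "((\<lambda>y. J y * g y u v) has_derivative (\<lambda>w. J x * Dg w u v + J x * \<tau> w * g x u v))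
      (at x within S)" for u v
    using dJ Dg by (auto intro!: derivative_eq_intros simp: at_eq)

  have "(\<lambda>y. Z y v) differentiable (at x within S)" for v
  proof (rule differentiable_linear_system[OF x])
    show "det (N y) \<noteq> 0" if "y \<in> S" for y
      using A(2)[OF that] det_gram_matrix_pos[OF h[OF that]] by (simp add: N_def det_mul det_transpose)
    show "N y *v Z y v = (\<chi> i. J y * g y (axis i 1) v)" if "y \<in> S" for y
    proof -
      have "(N y *v Z y v) $ i = h y (A y (axis i 1)) (Z y v)" for i
        unfolding linear_eq_sum_axis[OF lin_h(2)[OF that], of _ "Z y v"]
        by (simp add: matrix_vector_mult_def N_nth[OF that] mult.commute)
      then show ?thesis by (simp add: vec_eq_iff Z'[OF that])
    qed
    show "(\<lambda>y. N y $ i $ j) differentiable (at x within S)" for i j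
      using has_derivative_transform[OF x N_nth dAu] by (rule differentiableI)
    show "(\<lambda>y. (\<chi> i. J y * g y (axis i 1) v) $ i) differentiable (at x within S)" for i
      using differentiableI[OF dJg[of "axis i 1" v]] by simp
  qed
  then obtain dZ where "\<forall>v. ((\<lambda>y. Z y v) has_derivative dZ v) (at x within S)"
    using family_has_derivative[of "\<lambda>v y. Z y v"] by blast
  then have dZ: "((\<lambda>y. Z y v) has_derivative dZ v) (at x within S)" for v
    by (rule spec)
  have hderiv_Z: "hderiv (\<lambda>y. Z y v) x = dZ v" for v
    using dZ[of v] xH by (intro hderiv_eq) (simp_all add: at_eq)

  (* The covariant derivative of A: the second fundamental form of the underlying map. *)
  define B where "B w u = D2 w u + \<Gamma>' (A x w) (A x u) - A x (\<Gamma> w u)" for w u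
  have B_sym: "B w u = B u w" for u w
    unfolding B_def using D2[of w u] sym_\<Gamma>[of w u] sym_\<Gamma>'[of "A x w" "A x u"] by simp
  have lin_B: "linear (B w)" for w
    unfolding B_def by (rule linearI)
      (simp_all add: linear_add[OF lin_D2] linear_add[OF lin_\<Gamma>'(1)] linear_add[OF linA] linear_add[OF lin_\<Gamma>]
        linear_scale[OF lin_D2] linear_scale[OF lin_\<Gamma>'(1)] linear_scale[OF linA] linear_scale[OF lin_\<Gamma>]
        algebra_simps)

  (* The trace is invariant under conjugation by A x, which moves the target coefficients to the source. *)
  have \<tau>_eq: "J x * \<tau> w = (\<Sum>j\<in>UNIV. h x (B w (E j)) (Z x (E j)))" for w
  proof -
    define T where "T u = Ai *v B w u" for u
    have linT: "linear T"
      unfolding T_def using linear_compose[OF lin_B lin_Ai] by (simp add: o_def)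
    have "trace (matrix T) = trace (matrix (\<lambda>u. Ai *v D2 w u))
        + trace (matrix (\<lambda>u. Ai *v (\<Gamma>' (A x w) (A x u)))) - trace (matrix (\<Gamma> w))"
      by (simp add: T_def B_def trace_def matrix_def linear_add[OF lin_Ai] linear_diff[OF lin_Ai] Ai_A
          sum.distrib sum_subtractf)
    moreover have "trace (matrix (\<lambda>u. Ai *v D2 w u)) = trace (matrix (D2 w) ** Ai)"
      using matrix_compose[OF lin_D2 lin_Ai, of w] by (simp add: o_def trace_mul_sym[of Ai])
    moreover have "trace (matrix (\<lambda>u. Ai *v (\<Gamma>' (A x w) (A x u)))) = trace (matrix (\<Gamma>' (A x w)))"
    proof -
      have "matrix (\<lambda>u. Ai *v (\<Gamma>' (A x w) (A x u))) = Ai ** (matrix (\<Gamma>' (A x w)) ** MA)"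
        using matrix_compose[OF linear_compose[OF linA lin_\<Gamma>'(1)] lin_Ai, of "A x w"]
          matrix_compose[OF linA lin_\<Gamma>'(1), of "A x w"]
        by (simp add: o_def MA_def)
      then have "trace (matrix (\<lambda>u. Ai *v (\<Gamma>' (A x w) (A x u)))) = trace (matrix (\<Gamma>' (A x w)) ** MA ** Ai)"
        by (simp only: trace_mul_sym[of Ai])
      then show ?thesis by (simp add: Ai flip: matrix_mul_assoc)
    qed
    ultimately have "\<tau> w = trace (matrix T)"
      by (simp add: \<tau>_def)
    also have "\<dots> = (\<Sum>j\<in>UNIV. g x (T (E j)) (E j))"
      by (rule trace_orthonormal_basis[OF g[OF x] E linT])
    finally show ?thesis
      by (simp add: sum_distrib_left T_def A_Ai flip: Z'[OF x])
  qed

  (* The covariant derivative of Z. *)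
  define R where "R w v = dZ v w + \<Gamma>' (A x w) (Z x v) - Z x (\<Gamma> w v)" for w v
  have hR: "h x (A x u) (R w v) = J x * \<tau> w * g x u v - h x (B w u) (Z x v)" for u v w
  proof -
    have 1: "((\<lambda>y. h y (A y u) (Z y v)) has_derivative
        (\<lambda>w. Dh (A x w) (A x u) (Z x v) + h x (D2 w u) (Z x v) + h x (A x u) (dZ v w))) (at x within S)"
      using x bil_h bil_Dh Dh[unfolded at_eq] DA[unfolded at_eq, of u] dZ
      by (rule has_derivative_bilinear_family)
    have "((\<lambda>y. h y (A y u) (Z y v)) has_derivative (\<lambda>w. J x * Dg w u v + J x * \<tau> w * g x u v)) (at x within S)"
      using has_derivative_transform[OF x Z' dJg] .
    then have "(\<lambda>w. Dh (A x w) (A x u) (Z x v) + h x (D2 w u) (Z x v) + h x (A x u) (dZ v w))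
        = (\<lambda>w. J x * Dg w u v + J x * \<tau> w * g x u v)"
      using 1 has_derivative_half_space_unique[OF xH] by (simp add: at_eq)
    then have "Dh (A x w) (A x u) (Z x v) + h x (D2 w u) (Z x v) + h x (A x u) (dZ v w)
        = J x * Dg w u v + J x * \<tau> w * g x u v"
      by (rule fun_cong)
    then show ?thesis
      unfolding R_def B_def Dh_eq Dg_eq
      by (simp add: linear_add[OF lin_h(2)[OF x]] linear_diff[OF lin_h(2)[OF x]]
          bilinear_ladd[OF bil_h[OF x]] bilinear_lsub[OF bil_h[OF x]] Z'[OF x] algebra_simps)
  qed

  define r where "r = (\<Sum>i\<in>UNIV. R (E i) (E i))"
  have "h x (A x u) r = 0" for u
  proof -
    have u: "u = (\<Sum>i\<in>UNIV. g x u (E i) *\<^sub>R E i)"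
      by (rule orthonormal_coords[OF g[OF x] E])
    have "h x (A x u) r = (\<Sum>i\<in>UNIV. g x u (E i) * (\<Sum>j\<in>UNIV. h x (B (E i) (E j)) (Z x (E j))))
        - (\<Sum>i\<in>UNIV. h x (B (E i) u) (Z x (E i)))"
      by (simp add: r_def linear_sum[OF lin_h(2)[OF x]] hR \<tau>_eq sum_subtractf mult.commute)
    also have "(\<Sum>i\<in>UNIV. g x u (E i) * (\<Sum>j\<in>UNIV. h x (B (E i) (E j)) (Z x (E j))))
        = (\<Sum>j\<in>UNIV. \<Sum>i\<in>UNIV. g x u (E i) * h x (B (E i) (E j)) (Z x (E j)))"
      by (simp only: sum_distrib_left) (rule sum.swap)
    also have "\<dots> = (\<Sum>j\<in>UNIV. \<Sum>i\<in>UNIV. g x u (E i) * h x (B (E j) (E i)) (Z x (E j)))"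
      by (intro sum.cong refl) (subst B_sym, rule refl)
    also have "\<dots> = (\<Sum>j\<in>UNIV. h x (B (E j) u) (Z x (E j)))"
    proof (rule sum.cong[OF refl])
      fix j
      have "B (E j) u = (\<Sum>i\<in>UNIV. g x u (E i) *\<^sub>R B (E j) (E i))"
        by (subst u) (simp add: linear_sum[OF lin_B] linear_scale[OF lin_B])
      then show "(\<Sum>i\<in>UNIV. g x u (E i) * h x (B (E j) (E i)) (Z x (E j))) = h x (B (E j) u) (Z x (E j))"
        by (simp add: linear_sum[OF lin_h(1)[OF x]] bilinear_lmul[OF bil_h[OF x]])
    qed
    finally show ?thesis by simp
  qed
  from this[of "Ai *v r"] have "h x r r = 0"
    by (simp add: A_Ai)
  then have "r = 0"
    using h[OF x] unfolding inner_product_def by (metis less_irrefl)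
  then show ?thesis
    by (simp add: r_def R_def hderiv_Z)
qed

section \<open>Charts, metrics and Christoffel symbols\<close>

lemma chart_openin:
  assumes "smooth_manifold M" "c \<in> mfd_atlas M"
  shows "openin (mfd_top M) (fst c)" and "openin (top_of_set half_space) (snd c ` fst c)"
    and "homeomorphic_map (subtopology (mfd_top M) (fst c)) (top_of_set (snd c ` fst c)) (snd c)"
  using assms by (simp_all add: smooth_manifold_def)

lemma topspace_chart:
  assumes "smooth_manifold M" "c \<in> mfd_atlas M"
  shows "topspace (subtopology (mfd_top M) (fst c)) = fst c"
  using openin_subset[OF chart_openin(1)[OF assms]] by auto

lemma chart_inv_chart:
  assumes "smooth_manifold M" "c \<in> mfd_atlas M" "q \<in> fst c"
  shows "chart_inv c (snd c q) = q"
proof -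
  have "inj_on (snd c) (fst c)"
    using homeomorphic_imp_injective_map[OF chart_openin(3)[OF assms(1,2)]]
    by (simp only: topspace_chart[OF assms(1,2)])
  then show ?thesis
    using assms(3) by (simp add: chart_inv_def)
qed

lemma openin_chart_image:
  assumes M: "smooth_manifold M" "c \<in> mfd_atlas M" and Q: "openin (mfd_top M) Q" "Q \<subseteq> fst c"
  shows "openin (top_of_set half_space) (snd c ` Q)"
proof -
  have "openin (subtopology (mfd_top M) (fst c)) Q"
    using Q by (simp add: openin_subtopology_alt) blast
  then have "openin (top_of_set (snd c ` fst c)) (snd c ` Q)"
    using homeomorphic_imp_open_map[OF chart_openin(3)[OF M]] by (simp add: open_map_def)
  then show ?thesis
    using chart_openin(2)[OF M] by (rule openin_trans)
qed

text \<open>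
  Continuity of a function with values in \<open>{1, -1}\<close> makes it locally constant.
\<close>

lemma openin_orientation_level:
  assumes M: "oriented_riemannian_manifold M" "c \<in> mfd_atlas M" and s: "s \<in> {1, -1}"
  shows "openin (mfd_top M) {q \<in> fst c. mfd_orient M c q = s}"
proof -
  have sm: "smooth_manifold M" and "orientation M"
    using M by (simp_all only: oriented_riemannian_manifold_def)
  then have orient: "\<forall>q\<in>fst c. mfd_orient M c q \<in> {1, -1}"
    and cont: "continuous_map (subtopology (mfd_top M) (fst c)) euclideanreal (mfd_orient M c)"
    using M(2) unfolding orientation_def by blast+
  have "openin (subtopology (mfd_top M) (fst c))
      {q \<in> topspace (subtopology (mfd_top M) (fst c)). mfd_orient M c q \<in> {s - 1<..<s + 1}}"
    using cont by (rule openin_continuous_map_preimage) simp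
  moreover have "{q \<in> fst c. mfd_orient M c q \<in> {s - 1<..<s + 1}} = {q \<in> fst c. mfd_orient M c q = s}"
  proof (rule Collect_cong, rule conj_cong[OF refl])
    fix q assume "q \<in> fst c"
    then have "mfd_orient M c q = 1 \<or> mfd_orient M c q = -1" using orient by blast
    then show "mfd_orient M c q \<in> {s - 1<..<s + 1} \<longleftrightarrow> mfd_orient M c q = s"
      using s by (elim disjE insertE emptyE) simp_all
  qed
  ultimately have "openin (subtopology (mfd_top M) (fst c)) {q \<in> fst c. mfd_orient M c q = s}"
    by (simp only: topspace_chart[OF sm M(2)])
  then show ?thesis
    by (rule openin_trans_full) (rule chart_openin(1)[OF sm M(2)])
qed

text \<open>
  Derivatives on the half-space are unique, so the algebraic identities of the family pass to its
  derivative.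
\<close>

lemma bilinear_derivative:
  fixes Q :: "'d::{finite,linorder} rvec \<Rightarrow> 'e::finite rvec \<Rightarrow> 'e rvec \<Rightarrow> real"
  assumes S: "openin (top_of_set half_space) S" "x \<in> S" and Q: "\<And>y. y \<in> S \<Longrightarrow> bilinear (Q y)"
    and DQ: "\<And>u v. ((\<lambda>y. Q y u v) has_derivative (\<lambda>w. DQ w u v)) (at x within half_space)"
  shows "bilinear (DQ w)"
proof -
  have at_eq: "at x within half_space = at x within S"
    by (rule at_within_openin[OF S])
  have xH: "x \<in> half_space" using S openin_imp_subset by blast
  have eq: "D = D'" if "((\<lambda>y. F y) has_derivative D) (at x within half_space)"
    "((\<lambda>y. F' y) has_derivative D') (at x within half_space)" "\<And>y. y \<in> S \<Longrightarrow> F y = F' y"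
    for F F' :: "'d rvec \<Rightarrow> real" and D D'
    using has_derivative_transform[OF S(2) that(3), unfolded at_eq[symmetric], OF _ that(2)]
      has_derivative_half_space_unique[OF xH that(1)] by blast
  have "DQ w (u + u') v = DQ w u v + DQ w u' v" for u u' v
    using fun_cong[OF eq[OF DQ has_derivative_add[OF DQ DQ] bilinear_ladd[OF Q]]] .
  moreover have "DQ w (r *\<^sub>R u) v = r * DQ w u v" for r u v
    using fun_cong[OF eq[OF DQ has_derivative_mult_right[OF DQ], of "r *\<^sub>R u" v r u v]]
    by (simp add: bilinear_lmul[OF Q])
  moreover have "DQ w u (v + v') = DQ w u v + DQ w u v'" for u v v'
    using fun_cong[OF eq[OF DQ has_derivative_add[OF DQ DQ] bilinear_radd[OF Q]]] .
  moreover have "DQ w u (r *\<^sub>R v) = r * DQ w u v" for r u v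
    using fun_cong[OF eq[OF DQ has_derivative_mult_right[OF DQ], of u "r *\<^sub>R v" r u v]]
    by (simp add: bilinear_rmul[OF Q])
  ultimately show ?thesis
    unfolding bilinear_def by (intro conjI allI linearI) simp_all
qed

lemma metric_has_derivative:
  assumes M: "oriented_riemannian_manifold M" "c \<in> mfd_atlas M" "p \<in> fst c"
  shows "((\<lambda>y. mfd_metric M c (chart_inv c y) u v) has_derivative (\<lambda>w. metric_deriv M c p w u v))
    (at (snd c p) within half_space)"
  using smooth_on_has_hderiv[of "snd c ` fst c" "\<lambda>y. mfd_metric M c (chart_inv c y) u v" "snd c p"]
    chart_openin(2)[of M c] M
  by (simp add: metric_deriv_def oriented_riemannian_manifold_def riemannian_metric_def)

lemma inner_product_metric:
  assumes "oriented_riemannian_manifold M" "c \<in> mfd_atlas M" "p \<in> fst c"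
  shows "inner_product (mfd_metric M c p)"
  using assms by (simp add: oriented_riemannian_manifold_def riemannian_metric_def)

lemma christoffel_levi_civita:
  assumes M: "oriented_riemannian_manifold M" "c \<in> mfd_atlas M" "p \<in> fst c"
  shows "levi_civita_coeff (mfd_metric M c p) (metric_deriv M c p) (christoffel M c p)"
proof -
  let ?S = "snd c ` fst c"
  have sm: "smooth_manifold M" using M(1) by (simp only: oriented_riemannian_manifold_def)
  have S: "openin (top_of_set half_space) ?S" "snd c p \<in> ?S"
    using chart_openin(2)[OF sm M(2)] M(3) by simp_all
  have xH: "snd c p \<in> half_space"
    using openin_imp_subset[OF S(1)] S(2) by (rule subsetD)
  have ip: "inner_product (mfd_metric M c (chart_inv c y))" if y: "y \<in> ?S" for y
  proof -
    obtain q where "q \<in> fst c" "y = snd c q" using y by (rule imageE)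
    then show ?thesis
      using inner_product_metric[OF M(1,2)] by (simp only: chart_inv_chart[OF sm M(2)])
  qed
  have "bilinear (metric_deriv M c p w)" for w
    using S ip[unfolded inner_product_def, THEN conjunct1] metric_has_derivative[OF M]
    by (rule bilinear_derivative)
  moreover have "metric_deriv M c p w u v = metric_deriv M c p w v u" for w u v
  proof -
    have "mfd_metric M c (chart_inv c y) u v = mfd_metric M c (chart_inv c y) v u" if "y \<in> ?S" for y
      using ip[OF that] unfolding inner_product_def by (elim conjE allE)
    then have "((\<lambda>y. mfd_metric M c (chart_inv c y) u v) has_derivative (\<lambda>w. metric_deriv M c p w v u))
        (at (snd c p) within ?S)"
      by (rule has_derivative_transform[OF S(2), OF _ metric_has_derivative[OF M, of v u,
            unfolded at_within_openin[OF S]]])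
    then have "(\<lambda>w. metric_deriv M c p w u v) = (\<lambda>w. metric_deriv M c p w v u)"
      by (rule has_derivative_half_space_unique[OF xH metric_has_derivative[OF M],
            unfolded at_within_openin[OF S]])
    then show ?thesis by (rule fun_cong)
  qed
  moreover have "linear (\<lambda>w. metric_deriv M c p w u v)" for u v
    using metric_has_derivative[OF M] by (rule has_derivative_linear)
  ultimately have "\<exists>!\<Gamma>. levi_civita_coeff (mfd_metric M c p) (metric_deriv M c p) \<Gamma>"
    by (rule levi_civita_coeff_ex1[OF inner_product_metric[OF M]])
  then show ?thesis
    unfolding christoffel_def by (rule theI')
qed

section \<open>The coderivative of the cofactor\<close>

text \<open>
  A smooth left inverse suffices: by the chain rule its derivative is a left inverse of that of \<open>F\<close>.
\<close>

lemma det_derivative_nonzero: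
  fixes F :: "'d::{finite,linorder} rvec \<Rightarrow> 'd rvec"
  assumes S: "openin (top_of_set half_space) S" "y \<in> S"
    and F: "(F has_derivative A) (at y within half_space)"
    and k: "smooth_on T k" "F ` S \<subseteq> T" "\<And>z. z \<in> S \<Longrightarrow> k (F z) = z"
  shows "det (matrix A) \<noteq> 0"
proof -
  have at_eq: "at y within half_space = at y within S"
    by (rule at_within_openin[OF S])
  have "F y \<in> T" using k(2) S(2) by blast
  then obtain D where "(k has_derivative D) (at (F y) within T)"
    using smooth_on_imp_differentiable[OF k(1)] by blast
  then have D: "(k has_derivative D) (at (F y) within F ` S)"
    using k(2) by (rule has_derivative_subset)
  have "((\<lambda>z. k (F z)) has_derivative (\<lambda>w. D (A w))) (at y within S)"
    using F[unfolded at_eq] D by (rule has_derivative_in_compose)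
  then have "((\<lambda>z. z) has_derivative (\<lambda>w. D (A w))) (at y within S)"
    by (rule has_derivative_transform[OF S(2), rotated]) (simp add: k(3))
  then have "((\<lambda>z. z) has_derivative (\<lambda>w. D (A w))) (at y within half_space)"
    unfolding at_eq .
  moreover have "y \<in> half_space" using S openin_imp_subset by blast
  ultimately have "(\<lambda>w. D (A w)) = (\<lambda>w. w)"
    using has_derivative_half_space_unique has_derivative_ident by blast
  then have "matrix (D \<circ> A) = mat 1"
    by (simp add: o_def matrix_id_mat_1[unfolded id_def])
  then have "matrix D ** matrix A = mat 1"
    using matrix_compose[OF has_derivative_linear[OF F] has_derivative_linear[OF D]] by simp
  then have "det (matrix D) * det (matrix A) = 1"
    by (simp flip: det_mul)
  then show ?thesis by auto
qed

theorem corollary3p5: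
  fixes M1 :: "('a, 'd::{finite,linorder}) riem_mfd"
    and M2 :: "('b, 'd) riem_mfd"
    and f :: "'a \<Rightarrow> 'b"
  assumes "oriented_riemannian_manifold M1"
    and "oriented_riemannian_manifold M2"
    and "local_diffeomorphism M1 M2 f"
  shows "\<forall>c\<in>mfd_atlas M1. \<forall>c'\<in>mfd_atlas M2. \<forall>p\<in>fst c. f p \<in> fst c' \<longrightarrow>
           coderivative M1 M2 f (Cof_differential M1 M2 f) c c' p = 0"
proof (intro ballI impI)
  fix c c' p
  assume c: "c \<in> mfd_atlas M1" and c': "c' \<in> mfd_atlas M2" and p: "p \<in> fst c" "f p \<in> fst c'"
  note M1 = assms(1) and M2 = assms(2) and f = assms(3)
  have sm: "smooth_manifold M1" "smooth_manifold M2"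
    using M1 M2 by (simp_all only: oriented_riemannian_manifold_def)
  have inv: "chart_inv c (snd c q) = q" if "q \<in> fst c" for q
    using chart_inv_chart[OF sm(1) c that] .
  have inv': "chart_inv c' (snd c' q) = q" if "q \<in> fst c'" for q
    using chart_inv_chart[OF sm(2) c' that] .
  have "p \<in> topspace (mfd_top M1)"
    using openin_subset[OF chart_openin(1)[OF sm(1) c]] p(1) by (rule subsetD)
  then obtain W where W: "openin (mfd_top M1) W" "p \<in> W" "inj_on f W"
    "smooth_map_on M1 M2 W f" "smooth_map_on M2 M1 (f ` W) (inv_into W f)"
    using f unfolding local_diffeomorphism_def by blast

  define s where "s = mfd_orient M1 c p"
  define t where "t = mfd_orient M2 c' (f p)"
  have s: "s \<in> {1, -1}" and t: "t \<in> {1, -1}"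
    using M1 M2 c c' p by (simp_all only: s_def t_def oriented_riemannian_manifold_def orientation_def)
  (* On the neighbourhood Q of p both orientation signs are constant, so they act as constants under the derivative. *)
  define V where "V = {r \<in> fst c'. mfd_orient M2 c' r = t}"
  define Q where "Q = {q \<in> fst c. mfd_orient M1 c q = s} \<inter> {q \<in> W. f q \<in> V}"
  define S where "S = snd c ` Q"
  define x where "x = snd c p"
  have "p \<in> Q" using p W by (simp add: Q_def V_def s_def t_def)
  then have x: "x \<in> S" by (simp add: S_def x_def)
  have Q: "q \<in> fst c" "q \<in> W" "f q \<in> fst c'" "mfd_orient M1 c q = s" "mfd_orient M2 c' (f q) = t"
    if "q \<in> Q" for q
    using that by (simp_all add: Q_def V_def)
  have "openin (mfd_top M1) Q"
  proof -
    have "continuous_map (subtopology (mfd_top M1) W) (mfd_top M2) f"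
      using W(4) by (simp add: smooth_map_on_def)
    then have "openin (subtopology (mfd_top M1) W) {q \<in> topspace (subtopology (mfd_top M1) W). f q \<in> V}"
      using openin_orientation_level[OF M2 c' t] unfolding V_def
      by (rule openin_continuous_map_preimage)
    moreover have "topspace (subtopology (mfd_top M1) W) = W"
      using openin_subset[OF W(1)] by (simp add: topspace_subtopology Int_absorb1)
    ultimately have "openin (mfd_top M1) {q \<in> W. f q \<in> V}"
      using openin_trans_full[OF _ W(1)] by (simp only:)
    then show ?thesis
      unfolding Q_def using openin_orientation_level[OF M1 c s] by (intro openin_Int)
  qed
  then have S: "openin (top_of_set half_space) S"
    unfolding S_def using Q(1) by (intro openin_chart_image[OF sm(1) c]) auto

  define F where "F = snd c' \<circ> f \<circ> chart_inv c"
  have F: "F (snd c q) = snd c' (f q)" if "q \<in> fst c" for q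
    by (simp add: F_def inv[OF that])
  have "smooth_on (snd c ` {q \<in> fst c \<inter> W. f q \<in> fst c'}) F"
    using W(4) c c' by (simp add: smooth_map_on_def F_def)
  then have smooth_F: "smooth_on S F"
    by (rule smooth_on_subset) (auto simp: S_def dest: Q)
  note dF = smooth_on_has_hderiv[OF S smooth_F]
  have nz: "det (matrix (hderiv F y)) \<noteq> 0" if y: "y \<in> S" for y
  proof -
    let ?k = "snd c \<circ> inv_into W f \<circ> chart_inv c'"
    let ?T = "snd c' ` {r \<in> fst c' \<inter> f ` W. inv_into W f r \<in> fst c}"
    have "smooth_on ?T ?k"
      using W(5) c c' by (simp add: smooth_map_on_def)
    moreover have "F ` S \<subseteq> ?T"
    proof
      fix z assume "z \<in> F ` S"
      then obtain q where q: "q \<in> Q" "z = snd c' (f q)"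
        using F Q(1) by (auto simp: S_def)
      then show "z \<in> ?T"
        using Q[OF q(1)] W(3) by (intro image_eqI[of _ _ "f q"]) auto
    qed
    moreover have "?k (F z) = z" if z: "z \<in> S" for z
    proof -
      obtain q where q: "q \<in> Q" "z = snd c q" using z by (auto simp: S_def)
      then show ?thesis
        using F Q[OF q(1)] inv' W(3) by simp
    qed
    ultimately show ?thesis
      by (rule det_derivative_nonzero[OF S y dF[OF y]])
  qed

  obtain D2 where D2: "\<forall>u. ((\<lambda>y. hderiv F y u) has_derivative (\<lambda>w. D2 w u)) (at x within half_space)"
    "\<forall>u w. D2 w u = D2 u w"
    using smooth_on_second_derivative[OF S smooth_F x] by blast

  define g where "g y = mfd_metric M1 c (chart_inv c y)" for y
  define h where "h y = mfd_metric M2 c' (f (chart_inv c y))" for y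
  define Z where "Z y = Cof_differential M1 M2 f c c' (chart_inv c y)" for y
  have g: "inner_product (g y)" and h: "inner_product (h y)"
    and Z: "Z y = Cof (g y) s (h y) t (hderiv F y)" if y: "y \<in> S" for y
  proof -
    obtain q where q: "q \<in> Q" "y = snd c q" using y by (auto simp: S_def)
    show "inner_product (g y)" "inner_product (h y)"
      using inner_product_metric[OF M1 c] inner_product_metric[OF M2 c'] Q[OF q(1)] q(2)
      by (simp_all add: g_def h_def inv)
    show "Z y = Cof (g y) s (h y) t (hderiv F y)"
      using Q[OF q(1)] q(2)
      by (simp add: Z_def Cof_differential_def differential_def g_def h_def inv F_def)
  qed
  have inv_x: "chart_inv c x = p" by (simp add: x_def inv p)
  have A_x: "differential f c c' p = hderiv F x"
    by (simp add: differential_def F_def x_def)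

  have Dg: "((\<lambda>y. g y u v) has_derivative (\<lambda>w. metric_deriv M1 c p w u v)) (at x within half_space)" for u v
    unfolding g_def x_def by (rule metric_has_derivative[OF M1 c p(1)])
  have Dh: "((\<lambda>y. h y u v) has_derivative (\<lambda>w. metric_deriv M2 c' (f p) (hderiv F x w) u v))
      (at x within half_space)" for u v
  proof -
    let ?m = "\<lambda>z. mfd_metric M2 c' (chart_inv c' z) u v"
    have F_x: "F x = snd c' (f p)" using F[OF p(1)] by (simp add: x_def)
    have "F ` S \<subseteq> half_space"
    proof -
      have "F ` S \<subseteq> snd c' ` fst c'" using F Q by (auto simp: S_def)
      then show ?thesis using openin_imp_subset[OF chart_openin(2)[OF sm(2) c']] by simp
    qed
    then have "(?m has_derivative (\<lambda>w. metric_deriv M2 c' (f p) w u v)) (at (F x) within F ` S)"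
      unfolding F_x by (rule has_derivative_subset[OF metric_has_derivative[OF M2 c' p(2)]])
    from has_derivative_in_compose[OF dF[OF x, unfolded at_within_openin[OF S x]] this]
    have "((\<lambda>y. ?m (F y)) has_derivative (\<lambda>w. metric_deriv M2 c' (f p) (hderiv F x w) u v)) (at x within S)" .
    then have "((\<lambda>y. h y u v) has_derivative (\<lambda>w. metric_deriv M2 c' (f p) (hderiv F x w) u v)) (at x within S)"
    proof (rule has_derivative_transform[OF x, rotated])
      fix y assume "y \<in> S"
      then obtain q where q: "q \<in> Q" "y = snd c q" by (auto simp: S_def)
      then show "h y u v = ?m (F y)"
        using Q[OF q(1)] by (simp add: h_def F inv inv')
    qed
    then show ?thesis by (simp only: at_within_openin[OF S x])
  qed

  have \<Gamma>: "levi_civita_coeff (g x) (metric_deriv M1 c p) (christoffel M1 c p)"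
    using christoffel_levi_civita[OF M1 c p(1)] by (simp add: g_def inv_x)
  have \<Gamma>': "levi_civita_coeff (h x) (metric_deriv M2 c' (f p)) (christoffel M2 c' (f p))"
    using christoffel_levi_civita[OF M2 c' p(2)] by (simp add: h_def inv_x)
  have adj: "h y (hderiv F y u) (Z y v) = s * t * det (matrix (hderiv F y)) *
      (sqrt (det (gram_matrix (h y))) / sqrt (det (gram_matrix (g y)))) * g y u v" if "y \<in> S" for y u v
    unfolding Z[OF that]
    by (rule Cof_adjoint[OF g[OF that] s h[OF that] t has_derivative_linear[OF dF[OF that]]])

  define E where "E = (SOME E. orthonormal_basis (mfd_metric M1 c p) E)"
  have E: "orthonormal_basis (g x) E"
    unfolding E_def g_def inv_x
    by (rule someI_ex[OF orthonormal_basis_exists[OF inner_product_metric[OF M1 c p(1)]]])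
  have "(\<Sum>i\<in>UNIV. hderiv (\<lambda>y. Z y (E i)) x (E i)
      + christoffel M2 c' (f p) (hderiv F x (E i)) (Z x (E i))
      - Z x (christoffel M1 c p (E i) (E i))) = 0"
    by (rule divergence_eq_0_of_adjoint_identity[OF S x g h has_derivative_linear[OF dF] nz
          D2(1)[rule_format] D2(2)[rule_format] Dg \<Gamma> Dh \<Gamma>' adj E])
  moreover have "form_cov_deriv M1 M2 f (Cof_differential M1 M2 f) c c' p w v
      = hderiv (\<lambda>y. Z y v) x w + christoffel M2 c' (f p) (hderiv F x w) (Z x v)
        - Z x (christoffel M1 c p w v)" for w v
  proof -
    have "x \<in> half_space" using openin_imp_subset[OF S] x by (rule subsetD)
    then have "hderiv (\<lambda>y. v) x = (\<lambda>w. 0)"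
      by (intro hderiv_eq has_derivative_const)
    then show ?thesis
      by (simp add: form_cov_deriv_def pullback_cov_deriv_def cov_deriv_def A_x Z_def inv_x o_def
          flip: x_def)
  qed
  ultimately show "coderivative M1 M2 f (Cof_differential M1 M2 f) c c' p = 0"
    by (simp add: coderivative_def Let_def flip: E_def)
qed

end
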